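(* Let $\Omega\subset\mathbb C$ be a domain, $h\in\mathscr W^{1,2}(\Omega)$ complex valued, and $\eta\in\mathscr C_0^\infty(\Omega)$ complex valued. For real $\varepsilon$ close to $0$ define $H_\varepsilon:\Omega\to\mathbb C$ by $H_\varepsilon(z)=h(\xi)$, where $z=\xi+\varepsilon\eta(\xi)$, $\xi\in\Omega$. Then $$\begin{aligned}\mathscr E[H_\varepsilon]=\;&\mathscr E[h]\;-\;4\varepsilon\operatorname{Re}\int_\Omega h_\xi\,\overline{h_{\bar\xi}}\;\eta_{\bar\xi}\,\mathbf{d}\xi\\&+4\varepsilon^2\left(\frac12\int_\Omega\left(|h_\xi|^2+|h_{\bar\xi}|^2\right)|\eta_{\bar\xi}|^2\,\mathbf{d}\xi+\operatorname{Re}\int_\Omega h_\xi\,\overline{h_{\bar\xi}}\;\eta_\xi\,\eta_{\bar\xi}\,\mathbf{d}\xi\right)+O(|\varepsilon|^3)\qquad\text{as }\varepsilon\to0.\end{aligned}$$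
   Context: Subscripts $\xi,\bar\xi$ denote the complex derivatives $\frac12(\partial_x-i\partial_y)$, $\frac12(\partial_x+i\partial_y)$; $\mathbf{d}\xi$ is the area element; $\mathscr E[h]=\int_\Omega(|h_\xi|^2+|h_{\bar\xi}|^2)\,\mathbf{d}\xi$ is the Dirichlet energy. For $\varepsilon$ sufficiently small (depending on $\eta$) the map $\xi\mapsto\xi+\varepsilon\eta(\xi)$ is a $\mathscr C^\infty$-diffeomorphism of $\Omega$ onto itself, so $H_\varepsilon$ is well defined. *)

theory Defs
  imports "HOL-Analysis.Analysis" "HOL-Library.Landau_Symbols"
begin

text \<open>
  The complex plane is regarded as a real two-dimensional space: differentiability and
  \<^const>\<open>frechet_derivative\<close> are real, and the directions \<open>1\<close> and \<open>\<i>\<close> are the coordinate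
  directions \<open>x\<close> and \<open>y\<close>. Functions on a domain \<open>\<Omega>\<close> are total functions whose values
  outside \<open>\<Omega>\<close> play no role; the elements of \<open>C0_infinity \<Omega>\<close> are extended by zero.
\<close>

definition partial :: "complex \<Rightarrow> (complex \<Rightarrow> complex) \<Rightarrow> complex \<Rightarrow> complex" where
  "partial v f z = frechet_derivative f (at z) v"

primrec C_k :: "nat \<Rightarrow> (complex \<Rightarrow> complex) \<Rightarrow> bool" where
  "C_k 0 f \<longleftrightarrow> continuous_on UNIV f"
| "C_k (Suc k) f \<longleftrightarrow> (\<forall>z. f differentiable at z) \<and> (\<forall>v. C_k k (partial v f))"

definition C0_infinity :: "complex set \<Rightarrow> (complex \<Rightarrow> complex) set" where
  "C0_infinity \<Omega> = {\<phi>. (\<forall>k. C_k k \<phi>) \<and>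
     compact (closure {z. \<phi> z \<noteq> 0}) \<and> closure {z. \<phi> z \<noteq> 0} \<subseteq> \<Omega>}"

definition d_xi :: "(complex \<Rightarrow> complex) \<Rightarrow> complex \<Rightarrow> complex" where
  "d_xi f z = (partial 1 f z - \<i> * partial \<i> f z) / 2"

definition d_xibar :: "(complex \<Rightarrow> complex) \<Rightarrow> complex \<Rightarrow> complex" where
  "d_xibar f z = (partial 1 f z + \<i> * partial \<i> f z) / 2"

definition locally_integrable :: "complex set \<Rightarrow> (complex \<Rightarrow> complex) \<Rightarrow> bool" where
  "locally_integrable \<Omega> f \<longleftrightarrow> (\<forall>K. compact K \<and> K \<subseteq> \<Omega> \<longrightarrow> set_integrable lebesgue K f)"

definition L2 :: "complex set \<Rightarrow> (complex \<Rightarrow> complex) \<Rightarrow> bool" where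
  "L2 \<Omega> f \<longleftrightarrow> set_borel_measurable lebesgue \<Omega> f \<and>
     set_integrable lebesgue \<Omega> (\<lambda>z. (cmod (f z))\<^sup>2)"

definition has_weak_partial ::
  "complex set \<Rightarrow> complex \<Rightarrow> (complex \<Rightarrow> complex) \<Rightarrow> (complex \<Rightarrow> complex) \<Rightarrow> bool" where
  "has_weak_partial \<Omega> v h g \<longleftrightarrow> locally_integrable \<Omega> h \<and> locally_integrable \<Omega> g \<and>
     (\<forall>\<phi>\<in>C0_infinity \<Omega>.
        (LINT z:\<Omega>|lebesgue. h z * partial v \<phi> z) = - (LINT z:\<Omega>|lebesgue. g z * \<phi> z))"

definition W12 :: "complex set \<Rightarrow> (complex \<Rightarrow> complex) set" where
  "W12 \<Omega> = {h. L2 \<Omega> h \<and> (\<forall>v\<in>{1, \<i>}. \<exists>g. has_weak_partial \<Omega> v h g \<and> L2 \<Omega> g)}"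

text \<open>
  Weak derivatives are unique only almost everywhere on \<open>\<Omega>\<close>; the choice below fixes a
  representative, and integrals over \<open>\<Omega>\<close> do not depend on it. If no weak derivative exists,
  the value is unspecified, so \<open>weak_partial\<close> and \<open>energy\<close> are meaningful on \<open>W12 \<Omega>\<close>.
\<close>

definition weak_partial :: "complex set \<Rightarrow> complex \<Rightarrow> (complex \<Rightarrow> complex) \<Rightarrow> complex \<Rightarrow> complex" where
  "weak_partial \<Omega> v h = (SOME g. has_weak_partial \<Omega> v h g)"

definition weak_d_xi :: "complex set \<Rightarrow> (complex \<Rightarrow> complex) \<Rightarrow> complex \<Rightarrow> complex" where
  "weak_d_xi \<Omega> h z = (weak_partial \<Omega> 1 h z - \<i> * weak_partial \<Omega> \<i> h z) / 2"

definition weak_d_xibar :: "complex set \<Rightarrow> (complex \<Rightarrow> complex) \<Rightarrow> complex \<Rightarrow> complex" where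
  "weak_d_xibar \<Omega> h z = (weak_partial \<Omega> 1 h z + \<i> * weak_partial \<Omega> \<i> h z) / 2"

definition energy :: "complex set \<Rightarrow> (complex \<Rightarrow> complex) \<Rightarrow> real" where
  "energy \<Omega> h =
     (LINT \<xi>:\<Omega>|lebesgue. (cmod (weak_d_xi \<Omega> h \<xi>))\<^sup>2 + (cmod (weak_d_xibar \<Omega> h \<xi>))\<^sup>2)"

definition perturb :: "(complex \<Rightarrow> complex) \<Rightarrow> real \<Rightarrow> complex \<Rightarrow> complex" where
  "perturb \<eta> \<epsilon> \<xi> = \<xi> + of_real \<epsilon> * \<eta> \<xi>"

definition inner_variation ::
  "complex set \<Rightarrow> (complex \<Rightarrow> complex) \<Rightarrow> (complex \<Rightarrow> complex) \<Rightarrow> real \<Rightarrow> complex \<Rightarrow> complex" where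
  "inner_variation \<Omega> h \<eta> \<epsilon> z = h (inv_into \<Omega> (perturb \<eta> \<epsilon>) z)"

end

theory Submission
  imports Defs
begin

text \<open>
  For small \<open>\<epsilon>\<close> the map \<open>f = perturb \<eta> \<epsilon>\<close> is a diffeomorphism of the whole plane (the contraction
  principle gives surjectivity) which is the identity off the support of \<open>\<eta>\<close> and hence preserves
  \<open>\<Omega>\<close>. Testing \<open>H = h \<circ> f\<^sup>-\<^sup>1\<close> against \<open>\<phi>\<close> and changing variables leads to the test functions
  \<open>(\<phi> \<circ> f) \<cdot> cof(Df)\<close>; since the cofactor matrix is divergence free, the weak derivatives of \<open>H\<close> are
  given by the chain rule. With \<open>a\<close>, \<open>b\<close> for the two complex derivatives of \<open>h\<close> and \<open>m\<close>, \<open>n\<close> for those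
  of \<open>\<eta>\<close>, a second change of variables writes \<open>energy \<Omega> H\<close> as the integral of
  \<open>((\<bar>a\<bar>\<^sup>2 + \<bar>b\<bar>\<^sup>2) (\<bar>F\<bar>\<^sup>2 + \<bar>B\<bar>\<^sup>2) - 4 Re (a cnj b B cnj F)) / (\<bar>F\<bar>\<^sup>2 - \<bar>B\<bar>\<^sup>2)\<close> with
  \<open>F = 1 + \<epsilon> m\<close> and \<open>B = \<epsilon> n\<close>, whose second order expansion in \<open>\<epsilon>\<close> has a remainder bounded by a
  constant times \<open>\<bar>\<epsilon>\<bar>\<^sup>3 (\<bar>a\<bar>\<^sup>2 + \<bar>b\<bar>\<^sup>2)\<close>.
\<close>

subsection \<open>Smooth functions of a complex variable\<close>

text \<open>The obstacle is that \<open>energy\<close> rests on representatives picked by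
  \<open>SOME\<close>: nothing can be computed from it before weak derivatives are known to be
  unique almost everywhere. This is what the explicit bump functions and the fundamental lemma of
  the calculus of variations are for. All transfers are pulled back along \<open>f\<close>:
  relations are stated as \<open>H (f z) = h z\<close>, and test functions are composed with
  \<open>f\<close>. So \<open>g\<close>, the inverse of \<open>f\<close>, is never differentiated;
  its continuity serves measurability and compactness of supports. The single power of the Jacobian
  in the denominator of the density is what remains when the factor \<open>J\<close> from the change
  of variables meets the factor \<open>1 / J\<^sup>2\<close> from the squared weak derivatives.
  Since \<open>h\<close> is only in \<open>W12\<close>, all constants in the expansion must come
  from sup bounds on the derivatives of \<open>\<eta>\<close>.\<close>

lemma partial_eqI: "(f has_derivative f') (at z) \<Longrightarrow> partial v f z = f' v"
  by (simp add: partial_def frechet_derivative_at[symmetric])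

text \<open>Bridge from derivatives found by the usual rules to \<open>partial\<close>; the closure
  properties of \<open>C_k\<close> go through it, by induction on the order.\<close>

lemma C_k_SucI:
  assumes "\<And>z. (f has_derivative f' z) (at z)" "\<And>v. C_k k (\<lambda>z. f' z v)"
  shows "C_k (Suc k) f"
proof -
  have "partial v f = (\<lambda>z. f' z v)" for v
    using partial_eqI[OF assms(1)] by auto
  with assms show ?thesis
    by (auto simp: differentiable_def)
qed

lemma C_k_has_derivative:
  "C_k (Suc k) f \<Longrightarrow> (f has_derivative (\<lambda>v. partial v f z)) (at z)"
  by (simp add: partial_def frechet_derivative_works[symmetric])

lemma C_k_partial: "C_k (Suc k) f \<Longrightarrow> C_k k (partial v f)"
  by simp

lemma C_k_Suc_D: "C_k (Suc k) f \<Longrightarrow> C_k k f"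
proof (induction k arbitrary: f)
  case 0
  then show ?case
    by (auto simp: continuous_on_eq_continuous_at intro: differentiable_imp_continuous_within)
next
  case (Suc k)
  then show ?case by (metis C_k.simps(2))
qed

lemma C_k_const: "C_k k (\<lambda>z. c)"
proof (induction k arbitrary: c)
  case (Suc k)
  show ?case by (rule C_k_SucI[where f' = "\<lambda>z v. 0"]) (auto intro: Suc)
qed simp

lemma C_k_linear: "bounded_linear L \<Longrightarrow> C_k k f \<Longrightarrow> C_k k (\<lambda>z. L (f z))"
proof (induction k arbitrary: f)
  case 0
  then show ?case by (auto intro: bounded_linear.continuous_on)
next
  case (Suc k)
  show ?case
  proof (rule C_k_SucI)
    show "((\<lambda>z. L (f z)) has_derivative (\<lambda>v. L (partial v f z))) (at z)" for z
      by (rule bounded_linear.has_derivative[OF Suc.prems(1) C_k_has_derivative[OF Suc.prems(2)]])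
    show "C_k k (\<lambda>z. L (partial v f z))" for v
      using Suc by simp
  qed
qed

lemma C_k_add: "C_k k f \<Longrightarrow> C_k k g \<Longrightarrow> C_k k (\<lambda>z. f z + g z)"
proof (induction k arbitrary: f g)
  case 0
  then show ?case by (auto intro: continuous_on_add)
next
  case (Suc k)
  show ?case
  proof (rule C_k_SucI)
    show "((\<lambda>z. f z + g z) has_derivative (\<lambda>v. partial v f z + partial v g z)) (at z)" for z
      by (intro has_derivative_add C_k_has_derivative[OF Suc.prems(1)] C_k_has_derivative[OF Suc.prems(2)])
    show "C_k k (\<lambda>z. partial v f z + partial v g z)" for v
      using Suc by simp
  qed
qed

lemma C_k_mult: "C_k k f \<Longrightarrow> C_k k g \<Longrightarrow> C_k k (\<lambda>z. f z * g z)"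
proof (induction k arbitrary: f g)
  case 0
  then show ?case by (auto intro: continuous_on_mult)
next
  case (Suc k)
  show ?case
  proof (rule C_k_SucI)
    show "((\<lambda>z. f z * g z) has_derivative (\<lambda>v. f z * partial v g z + partial v f z * g z)) (at z)" for z
      by (intro has_derivative_mult C_k_has_derivative[OF Suc.prems(1)] C_k_has_derivative[OF Suc.prems(2)])
    show "C_k k (\<lambda>z. f z * partial v g z + partial v f z * g z)" for v
      by (intro C_k_add Suc.IH C_k_partial C_k_Suc_D[OF Suc.prems(1)] C_k_Suc_D[OF Suc.prems(2)] Suc.prems)
  qed
qed

text \<open>The derivative is only real linear. Splitting a direction into coordinates is needed
  whenever the direction varies with the point, as it does in the chain rule.\<close>

lemma partial_real_linear:
  assumes "C_k (Suc k) f"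
  shows "partial v f z = of_real (Re v) * partial 1 f z + of_real (Im v) * partial \<i> f z"
proof -
  interpret bounded_linear "\<lambda>v. partial v f z"
    using C_k_has_derivative[OF assms] by (rule has_derivative_bounded_linear)
  have "v = Re v *\<^sub>R 1 + Im v *\<^sub>R \<i>"
    by (simp add: complex_eq_iff)
  then have "partial v f z = partial (Re v *\<^sub>R 1 + Im v *\<^sub>R \<i>) f z" by simp
  also have "\<dots> = Re v *\<^sub>R partial 1 f z + Im v *\<^sub>R partial \<i> f z"
    by (simp only: add scaleR)
  finally show ?thesis by (simp add: scaleR_conv_of_real)
qed

lemma bounded_linear_of_real_Re: "bounded_linear (\<lambda>z. complex_of_real (Re z))"
  by (intro bounded_linear_compose[OF bounded_linear_of_real bounded_linear_Re])

lemma bounded_linear_of_real_Im: "bounded_linear (\<lambda>z. complex_of_real (Im z))"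
  by (intro bounded_linear_compose[OF bounded_linear_of_real bounded_linear_Im])

lemma partial_compose:
  assumes "C_k (Suc k) \<phi>" "C_k (Suc k) f"
  shows "((\<lambda>z. \<phi> (f z)) has_derivative (\<lambda>v. partial (partial v f z) \<phi> (f z))) (at z)"
  by (rule has_derivative_compose[OF C_k_has_derivative[OF assms(2)] C_k_has_derivative[OF assms(1)]])

lemma C_k_compose: "C_k k \<phi> \<Longrightarrow> C_k k f \<Longrightarrow> C_k k (\<lambda>z. \<phi> (f z))"
proof (induction k arbitrary: \<phi> f)
  case 0
  then show ?case by (auto intro: continuous_on_compose2)
next
  case (Suc k)
  show ?case
  proof (rule C_k_SucI[OF partial_compose[OF Suc.prems]])
    fix v
    \<comment> \<open>The direction \<open>partial v f z\<close> depends on \<open>z\<close>, so the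
      induction hypothesis does not apply to \<open>partial (partial v f z) \<phi>\<close> itself;
      it does apply to the two coordinate derivatives of \<open>\<phi>\<close>.\<close>
    have "C_k k (\<lambda>z. of_real (Re (partial v f z)) * partial 1 \<phi> (f z)
        + of_real (Im (partial v f z)) * partial \<i> \<phi> (f z))"
      by (rule C_k_add; rule C_k_mult;
          rule C_k_linear[OF bounded_linear_of_real_Re C_k_partial[OF Suc.prems(2)]]
            C_k_linear[OF bounded_linear_of_real_Im C_k_partial[OF Suc.prems(2)]]
            Suc.IH[OF C_k_partial[OF Suc.prems(1)] C_k_Suc_D[OF Suc.prems(2)]])
    then show "C_k k (\<lambda>z. partial (partial v f z) \<phi> (f z))"
      unfolding partial_real_linear[OF Suc.prems(1), of "partial v f z" for z, symmetric] .
  qed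
qed

lemma C_k_continuous: "C_k k f \<Longrightarrow> continuous_on A f"
proof (induction k arbitrary: f)
  case 0
  then show ?case by (auto intro: continuous_on_subset)
qed (metis C_k_Suc_D)

definition smooth :: "(complex \<Rightarrow> complex) \<Rightarrow> bool" where
  "smooth f \<longleftrightarrow> (\<forall>k. C_k k f)"

lemma smooth_has_derivative: "smooth f \<Longrightarrow> (f has_derivative (\<lambda>v. partial v f z)) (at z)"
  by (metis C_k_has_derivative smooth_def)

lemma smooth_continuous: "smooth f \<Longrightarrow> continuous_on A f"
  by (metis C_k_continuous smooth_def)

lemma smooth_partial: "smooth f \<Longrightarrow> smooth (partial v f)"
  by (metis C_k.simps(2) smooth_def)

lemma smooth_const: "smooth (\<lambda>z. c)"
  and smooth_linear: "bounded_linear L \<Longrightarrow> smooth f \<Longrightarrow> smooth (\<lambda>z. L (f z))"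
  and smooth_add: "smooth f \<Longrightarrow> smooth g \<Longrightarrow> smooth (\<lambda>z. f z + g z)"
  and smooth_mult: "smooth f \<Longrightarrow> smooth g \<Longrightarrow> smooth (\<lambda>z. f z * g z)"
  and smooth_compose: "smooth \<phi> \<Longrightarrow> smooth f \<Longrightarrow> smooth (\<lambda>z. \<phi> (f z))"
  by (simp_all add: smooth_def C_k_const C_k_linear C_k_add C_k_mult C_k_compose)

lemma smooth_ident: "smooth (\<lambda>z. z)"
proof -
  have "C_k k (\<lambda>z. z)" for k
    by (cases k) (auto simp: partial_def[abs_def] frechet_derivative_ident C_k_const)
  then show ?thesis by (simp add: smooth_def)
qed

section \<open>Symmetry of second partial derivatives\<close>

lemma has_vector_derivative_along_line:
  assumes "smooth f"
  shows "((\<lambda>t. f (a + of_real t * v)) has_vector_derivative partial v f (a + of_real t * v)) (at t within S)"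
proof -
  have "((\<lambda>t. a + of_real t * v) has_vector_derivative v) (at t within S)"
    by (auto intro!: derivative_eq_intros)
  from vector_derivative_diff_chain_within[OF this
      has_derivative_at_withinI[OF smooth_has_derivative[OF assms]]]
  show ?thesis by (simp add: o_def)
qed

text \<open>Write the increment of \<open>f\<close> in the \<open>y\<close> direction as an integral
  of \<open>partial \<i> f\<close>, differentiate under the integral sign in \<open>x\<close>, then
  differentiate in the upper limit. The result is needed for the divergence-free cofactor
  rows.\<close>

lemma partial_commute:
  assumes "smooth f"
  shows "partial 1 (partial \<i> f) z = partial \<i> (partial 1 f) z"
proof -
  define x where "x = Re z"
  define y where "y = Im z"
  have z: "z = of_real x + of_real y * \<i>"
    by (simp add: complex_eq_iff x_def y_def)
  define F where "F u t = partial \<i> f (of_real u + of_real t * \<i>)" for u t :: real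
  define F' where "F' u t = partial 1 (partial \<i> f) (of_real u + of_real t * \<i>)" for u t :: real
  have der_x: "((\<lambda>u. k (of_real u + of_real t * \<i>)) has_vector_derivative
      partial 1 k (of_real u + of_real t * \<i>)) (at u within S)" if "smooth k" for k t u S
    using has_vector_derivative_along_line[OF that, of "of_real t * \<i>" 1 u S]
    by (simp add: add.commute)
  have cont: "continuous_on S (\<lambda>p. k (of_real (fst p) + of_real (snd p) * \<i>))"
    if "smooth k" for k and S :: "(real \<times> real) set"
    by (rule continuous_on_compose2[OF smooth_continuous[OF that, of UNIV]])
      (auto intro!: continuous_intros)
  have cont1: "continuous_on S (F u)" "continuous_on S (F' u)" for u S
    unfolding F_def F'_def
    by (rule continuous_on_compose2[OF smooth_continuous[OF smooth_partial, of _ UNIV]];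
        auto intro!: continuous_intros smooth_partial assms)+
  \<comment> \<open>Integration starts at \<open>y - 1\<close> so that \<open>y\<close> is interior
    to \<open>{y - 1..y + 1}\<close> and the derivative in the upper limit at \<open>y\<close> is
    two-sided.\<close>
  have key: "partial 1 f (of_real x + of_real b * \<i>) = partial 1 f (of_real x + of_real (y - 1) * \<i>)
      + integral {y - 1..b} (F' x)" if b: "b \<ge> y - 1" for b
  proof -
    have int: "integral {y - 1..b} (F u)
        = f (of_real u + of_real b * \<i>) - f (of_real u + of_real (y - 1) * \<i>)" for u
      unfolding F_def
      by (rule integral_unique, rule fundamental_theorem_of_calculus[OF b])
        (rule has_vector_derivative_along_line[OF assms])
    have "((\<lambda>u. integral (cbox (y - 1) b) (F u)) has_vector_derivative
        integral (cbox (y - 1) b) (F' x)) (at x within UNIV)"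
    proof (rule leibniz_rule_vector_derivative)
      show "((\<lambda>u. F u t) has_vector_derivative F' u t) (at u within UNIV)" for u t
        unfolding F_def F'_def by (rule der_x[OF smooth_partial[OF assms]])
      show "F u integrable_on cbox (y - 1) b" for u
        by (intro integrable_continuous cont1)
      show "continuous_on (UNIV \<times> cbox (y - 1) b) (\<lambda>(u, t). F' u t)"
        unfolding F'_def case_prod_beta by (intro cont smooth_partial assms)
    qed auto
    then have "((\<lambda>u. f (of_real u + of_real b * \<i>) - f (of_real u + of_real (y - 1) * \<i>))
        has_vector_derivative integral {y - 1..b} (F' x)) (at x)"
      by (simp add: int)
    moreover have "((\<lambda>u. f (of_real u + of_real b * \<i>) - f (of_real u + of_real (y - 1) * \<i>))
        has_vector_derivative partial 1 f (of_real x + of_real b * \<i>) 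
          - partial 1 f (of_real x + of_real (y - 1) * \<i>)) (at x)"
      by (intro has_vector_derivative_diff der_x assms)
    ultimately show ?thesis
      by (auto dest: vector_derivative_unique_at simp: algebra_simps)
  qed
  have "((\<lambda>b. integral {y - 1..b} (F' x)) has_vector_derivative F' x y) (at y within {y - 1..y + 1})"
    by (rule integral_has_vector_derivative) (auto intro: cont1)
  then have "((\<lambda>b. partial 1 f (of_real x + of_real (y - 1) * \<i>) + integral {y - 1..b} (F' x))
      has_vector_derivative F' x y) (at y within {y - 1..y + 1})"
    by (auto intro!: derivative_eq_intros)
  then have "((\<lambda>b. partial 1 f (of_real x + of_real b * \<i>)) has_vector_derivative F' x y)
      (at y within {y - 1..y + 1})"
    by (rule has_vector_derivative_transform[rotated 2]) (auto simp: key)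
  then have "((\<lambda>b. partial 1 f (of_real x + of_real b * \<i>)) has_vector_derivative F' x y) (at y)"
    by (simp add: at_within_Icc_at)
  moreover have "((\<lambda>b. partial 1 f (of_real x + of_real b * \<i>)) has_vector_derivative
      partial \<i> (partial 1 f) z) (at y)"
    using has_vector_derivative_along_line[OF smooth_partial[OF assms, of 1], of "of_real x" \<i> y UNIV]
    by (simp add: z)
  ultimately show ?thesis
    by (metis vector_derivative_unique_at F'_def z)
qed

lemma partial_mult:
  assumes "smooth f" "smooth g"
  shows "partial v (\<lambda>z. f z * g z) z = f z * partial v g z + partial v f z * g z"
  by (rule partial_eqI[OF has_derivative_mult[OF smooth_has_derivative[OF assms(1)]
          smooth_has_derivative[OF assms(2)]]])

lemma partial_bounded_linear:
  assumes "bounded_linear L" "smooth f"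
  shows "partial v (\<lambda>z. L (f z)) z = L (partial v f z)"
  by (rule partial_eqI[OF bounded_linear.has_derivative[OF assms(1) smooth_has_derivative[OF assms(2)]]])

section \<open>Smooth test functions with compact support\<close>

lemma C0_infinityI:
  assumes "smooth \<phi>" "compact K" "K \<subseteq> \<Omega>" "\<And>z. z \<notin> K \<Longrightarrow> \<phi> z = 0"
  shows "\<phi> \<in> C0_infinity \<Omega>"
proof -
  have "closure {z. \<phi> z \<noteq> 0} \<subseteq> K"
    using assms by (intro closure_minimal compact_imp_closed) auto
  moreover from this have "compact (closure {z. \<phi> z \<noteq> 0})"
    by (rule compact_closure[THEN iffD2, OF bounded_subset[OF compact_imp_bounded[OF assms(2)]],
        OF order_trans[OF closure_subset]])
  ultimately show ?thesis
    using assms(1,3) unfolding C0_infinity_def smooth_def by blast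
qed

lemma C0_infinityE:
  assumes "\<phi> \<in> C0_infinity \<Omega>"
  obtains K where "smooth \<phi>" "compact K" "K \<subseteq> \<Omega>" "\<And>z. z \<notin> K \<Longrightarrow> \<phi> z = 0"
proof
  show "smooth \<phi>" "compact (closure {z. \<phi> z \<noteq> 0})" "closure {z. \<phi> z \<noteq> 0} \<subseteq> \<Omega>"
    using assms unfolding C0_infinity_def smooth_def by simp_all
  show "\<phi> z = 0" if "z \<notin> closure {z. \<phi> z \<noteq> 0}" for z
    using that closure_subset[of "{z. \<phi> z \<noteq> 0}"] by blast
qed

lemma C0_infinity_smooth: "\<phi> \<in> C0_infinity \<Omega> \<Longrightarrow> smooth \<phi>"
  by (auto simp: C0_infinity_def smooth_def)

lemma C0_infinity_mult:
  assumes "\<phi> \<in> C0_infinity \<Omega>" "smooth a"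
  shows "(\<lambda>z. \<phi> z * a z) \<in> C0_infinity \<Omega>"
  using assms(1)
  by (rule C0_infinityE) (rule C0_infinityI, auto intro: smooth_mult assms)

lemma C0_infinity_partial:
  assumes "\<phi> \<in> C0_infinity \<Omega>"
  shows "partial v \<phi> \<in> C0_infinity \<Omega>"
  using assms
proof (rule C0_infinityE)
  fix K assume K: "smooth \<phi>" "compact K" "K \<subseteq> \<Omega>" "\<And>z. z \<notin> K \<Longrightarrow> \<phi> z = 0"
  show ?thesis
  proof (rule C0_infinityI[OF smooth_partial[OF K(1)] K(2,3)])
    fix z assume z: "z \<notin> K"
    \<comment> \<open>The complement of \<open>K\<close> is open, so near \<open>z\<close> the
      function coincides with zero.\<close>
    have "((\<lambda>z. 0) has_derivative (\<lambda>v. 0)) (at z)" by simp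
    then have "(\<phi> has_derivative (\<lambda>v. 0)) (at z)"
      by (rule has_derivative_transform_within_open[of _ _ _ _ "- K"])
        (use K z in \<open>auto simp: compact_imp_closed\<close>)
    then show "partial v \<phi> z = 0" by (rule partial_eqI)
  qed
qed

lemma C0_infinity_bounded:
  assumes "\<phi> \<in> C0_infinity \<Omega>"
  shows "\<exists>B. \<forall>z. cmod (\<phi> z) \<le> B"
  using assms
proof (rule C0_infinityE)
  fix K assume K: "smooth \<phi>" "compact K" "K \<subseteq> \<Omega>" "\<And>z. z \<notin> K \<Longrightarrow> \<phi> z = 0"
  have "bounded (\<phi> ` K)"
    by (intro compact_imp_bounded compact_continuous_image smooth_continuous K)
  then obtain B where B: "\<And>z. z \<in> K \<Longrightarrow> cmod (\<phi> z) \<le> B"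
    by (auto simp: bounded_iff)
  have "cmod (\<phi> z) \<le> max B 0" for z
    using B[of z] K(4)[of z] by (cases "z \<in> K") auto
  then show ?thesis by blast
qed

subsection \<open>Uniqueness of weak derivatives\<close>

text \<open>For \<open>k = 0\<close> this is the classical smooth function that is flat at the
  origin. The powers of \<open>t\<close> make the family closed under differentiation up to linear
  combinations; the parameter \<open>c\<close> is there to tend to \<open>0\<close>, which turns the
  function into a step.\<close>

definition flat :: "real \<Rightarrow> nat \<Rightarrow> real \<Rightarrow> real" where
  "flat c k t = (if t > 0 then exp (- c / t) / t ^ k else 0)"

text \<open>With \<open>x = 1 / t\<close> the right-hand limit says that the exponential outgrows
  every power; on the left the function vanishes.\<close>

lemma flat_tendsto_0:
  assumes c: "c > 0"
  shows "(flat c k \<longlongrightarrow> 0) (at 0)"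
proof -
  have "((\<lambda>x. (c * x) ^ k / exp (c * x)) \<longlongrightarrow> 0) at_top"
    by (rule filterlim_compose[OF tendsto_power_div_exp_0])
      (rule filterlim_tendsto_pos_mult_at_top[OF tendsto_const c filterlim_ident])
  from tendsto_mult_right_zero[OF this, of "1 / c ^ k"]
  have "((\<lambda>x. flat c k (inverse x)) \<longlongrightarrow> 0) at_top"
    by (rule Lim_transform_eventually, intro eventually_mono[OF eventually_gt_at_top[of 0]])
      (use c in \<open>auto simp: flat_def exp_minus field_simps power_mult_distrib\<close>)
  then have "(flat c k \<longlongrightarrow> 0) (at_right 0)"
    by (simp add: filterlim_at_right_to_top)
  moreover have "(flat c k \<longlongrightarrow> 0) (at_left 0)"
    by (rule tendsto_eventually) (auto simp: eventually_at_filter flat_def)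
  ultimately show ?thesis
    by (simp add: filterlim_split_at)
qed

lemma flat_has_derivative:
  assumes c: "c > 0"
  shows "(flat c k has_real_derivative c * flat c (k + 2) t - k * flat c (k + 1) t) (at t)"
proof -
  consider "t < 0" | "t = 0" | "t > 0" by linarith
  then show ?thesis
  proof cases
    case 1
    then have "((\<lambda>t. 0) has_real_derivative c * flat c (k + 2) t - k * flat c (k + 1) t) (at t)"
      by (simp add: flat_def)
    then show ?thesis
      by (rule has_field_derivative_transform_within_open[where S = "{..<0}"])
        (use 1 in \<open>auto simp: flat_def\<close>)
  next
    case 2
    \<comment> \<open>At the origin the difference quotient is again a member of the family, so its
      limit is already known.\<close>
    have "(\<lambda>h. (flat c k (0 + h) - flat c k 0) / h) = flat c (k + 1)"
      by (auto simp: flat_def fun_eq_iff field_simps)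
    with flat_tendsto_0[OF c, of "k + 1"] 2 show ?thesis
      by (simp add: DERIV_def flat_def)
  next
    case 3
    have "((\<lambda>t. exp (- c / t) / t ^ k) has_real_derivative
        c * flat c (k + 2) t - k * flat c (k + 1) t) (at t)"
      using 3 
      apply (auto intro!: derivative_eq_intros simp: flat_def)
      apply (cases k)
      apply (simp_all add: field_simps power2_eq_square)
      done
    then show ?thesis
      by (rule has_field_derivative_transform_within_open[where S = "{0<..}"])
        (use 3 in \<open>auto simp: flat_def\<close>)
  qed
qed

text \<open>The induction on the order runs over all \<open>k\<close> at once, since differentiation
  raises \<open>k\<close> by one and two. The affine argument covers the four half-planes that bound
  a box.\<close>

lemma smooth_flat:
  assumes c: "c > 0" and l: "bounded_linear l"
  shows "smooth (\<lambda>z. of_real (flat c k (l z + a)))"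
proof -
  have cont: "continuous_on UNIV (\<lambda>z. complex_of_real (flat c k (l z + a)))" for k
  proof (rule continuous_on_of_real, rule continuous_at_imp_continuous_on, rule ballI)
    fix z
    have "isCont (\<lambda>z. l z + a) z"
      by (intro continuous_intros linear_continuous_at[OF l])
    then show "isCont (\<lambda>z. flat c k (l z + a)) z"
      by (rule isCont_o2) (rule DERIV_isCont[OF flat_has_derivative[OF c]])
  qed
  have "C_k n (\<lambda>z. of_real (flat c k (l z + a)))" for n
  proof (induction n arbitrary: k)
    case 0
    show ?case by (simp only: C_k.simps cont)
  next
    case (Suc n)
    show ?case
    proof (rule C_k_SucI)
      fix z
      have "((\<lambda>z. l z + a) has_derivative l) (at z)"
        by (auto intro!: derivative_eq_intros bounded_linear_imp_has_derivative l)
      from has_derivative_compose[OF this flat_has_derivative[OF c, THEN has_field_derivative_imp_has_derivative]]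
      have "((\<lambda>z. flat c k (l z + a)) has_derivative
          (\<lambda>v. (c * flat c (k + 2) (l z + a) - k * flat c (k + 1) (l z + a)) * l v)) (at z)" .
      from has_derivative_of_real[OF this]
      show "((\<lambda>z. complex_of_real (flat c k (l z + a))) has_derivative
          (\<lambda>v. (of_real c * of_real (flat c (k + 2) (l z + a))
             + of_real (- real k) * of_real (flat c (k + 1) (l z + a))) * of_real (l v))) (at z)"
        by simp
      show "C_k n (\<lambda>z. (of_real c * of_real (flat c (k + 2) (l z + a))
             + of_real (- real k) * of_real (flat c (k + 1) (l z + a))) * of_real (l v))" for v
        by (intro C_k_mult C_k_add C_k_const Suc)
    qed
  qed
  then show ?thesis by (simp add: smooth_def)
qed

text \<open>One factor per side of the box, so it is nonzero exactly on \<open>box a b\<close>. The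
  arguments have the form \<open>l z + a\<close> so that \<open>smooth_flat\<close> matches.\<close>

definition bump :: "complex \<Rightarrow> complex \<Rightarrow> real \<Rightarrow> complex \<Rightarrow> complex" where
  "bump a b c z = of_real (flat c 0 (Re z + - Re a)) * of_real (flat c 0 (- Re z + Re b))
     * of_real (flat c 0 (Im z + - Im a)) * of_real (flat c 0 (- Im z + Im b))"

lemma bump_in_C0_infinity:
  assumes "c > 0" "cbox a b \<subseteq> \<Omega>"
  shows "bump a b c \<in> C0_infinity \<Omega>"
proof (rule C0_infinityI[of _ "cbox a b"])
  show "smooth (bump a b c)"
    unfolding bump_def[abs_def]
    by (intro smooth_mult smooth_flat assms bounded_linear_Re bounded_linear_Im
        bounded_linear_minus)
  show "bump a b c z = 0" if "z \<notin> cbox a b" for z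
    using that by (auto simp: in_cbox_complex_iff bump_def flat_def)
qed (use assms in auto)

lemma flat_0_tendsto: "(\<lambda>n. flat (inverse (Suc n)) 0 t) \<longlonglongrightarrow> (if t > 0 then 1 else 0)"
proof (cases "t > 0")
  case True
  have "(\<lambda>n. exp (- inverse (real (Suc n)) / t)) \<longlonglongrightarrow> exp (- 0 / t)"
    by (intro tendsto_intros LIMSEQ_inverse_real_of_nat) (use True in auto)
  with True show ?thesis by (simp add: flat_def)
qed (simp add: flat_def)

lemma bump_tendsto: "(\<lambda>n. bump a b (inverse (Suc n)) z) \<longlonglongrightarrow> indicator (box a b) z"
proof -
  have "(\<lambda>n. bump a b (inverse (Suc n)) z) \<longlonglongrightarrow> of_real (if Re z + - Re a > 0 then 1 else 0)
     * of_real (if - Re z + Re b > 0 then 1 else 0)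
     * of_real (if Im z + - Im a > 0 then 1 else 0) * of_real (if - Im z + Im b > 0 then 1 else 0)"
    unfolding bump_def by (intro tendsto_mult tendsto_of_real flat_0_tendsto)
  then show ?thesis
    by (rule back_subst[of "\<lambda>x. _ \<longlonglongrightarrow> x"]) (auto simp: in_box_complex_iff indicator_def)
qed

lemma norm_bump_le_1: "c > 0 \<Longrightarrow> cmod (bump a b c z) \<le> 1"
  unfolding bump_def norm_mult norm_of_real
  by (intro mult_le_one mult_nonneg_nonneg) (auto simp: flat_def)

section \<open>The fundamental lemma of the calculus of variations\<close>

lemma locally_integrable_mult_C0:
  assumes g: "locally_integrable \<Omega> g" and \<phi>: "\<phi> \<in> C0_infinity \<Omega>"
  shows "set_integrable lebesgue \<Omega> (\<lambda>z. g z * \<phi> z)"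
proof -
  obtain K where K: "smooth \<phi>" "compact K" "K \<subseteq> \<Omega>" "\<And>z. z \<notin> K \<Longrightarrow> \<phi> z = 0"
    using \<phi> by (rule C0_infinityE) blast
  obtain B where B: "\<And>z. cmod (\<phi> z) \<le> B"
    using C0_infinity_bounded[OF \<phi>] by blast
  have int: "integrable lebesgue (\<lambda>z. indicator K z *\<^sub>R g z)"
    using g K by (auto simp: locally_integrable_def set_integrable_def)
  have meas: "\<phi> \<in> borel_measurable lebesgue"
    using smooth_continuous[OF K(1), of UNIV]
    by (simp add: borel_measurable_continuous_onI measurable_completion)
  have eq: "indicator \<Omega> z *\<^sub>R (g z * \<phi> z) = (indicator K z *\<^sub>R g z) * \<phi> z" for z
    using K by (auto simp: indicator_def)
  show ?thesis
    unfolding set_integrable_def eq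
  proof (rule Bochner_Integration.integrable_bound)
    show "integrable lebesgue (\<lambda>z. B * norm (indicator K z *\<^sub>R g z))"
      by (intro integrable_mult_right integrable_norm int)
    show "(\<lambda>z. (indicator K z *\<^sub>R g z) * \<phi> z) \<in> borel_measurable lebesgue"
      using int meas by (intro borel_measurable_times) auto
    have "0 \<le> B" using B[of 0] norm_ge_zero order_trans by blast
    then show "AE z in lebesgue. norm ((indicator K z *\<^sub>R g z) * \<phi> z) \<le> norm (B * norm (indicator K z *\<^sub>R g z))"
      by (auto simp: norm_mult mult.commute[of B] mult.assoc intro!: mult_left_mono B)
  qed
qed

text \<open>Test with bumps whose parameter \<open>inverse (Suc n)\<close> tends to
  \<open>0\<close>. They converge to the indicator of the open box and are at most \<open>1\<close>,
  so the norm of \<open>g\<close> on the closed box dominates.\<close>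

lemma set_integral_box_eq_0:
  assumes g: "locally_integrable \<Omega> g"
    and zero: "\<And>\<phi>. \<phi> \<in> C0_infinity \<Omega> \<Longrightarrow> (LINT z:\<Omega>|lebesgue. g z * \<phi> z) = 0"
    and sub: "cbox a b \<subseteq> \<Omega>"
  shows "(LINT z:box a b|lebesgue. g z) = 0"
proof -
  have int: "integrable lebesgue (\<lambda>z. indicator (cbox a b) z *\<^sub>R g z)"
    using g sub by (auto simp: locally_integrable_def set_integrable_def)
  let ?F = "\<lambda>n z. indicator \<Omega> z *\<^sub>R (g z * bump a b (inverse (Suc n)) z)"
  have "(\<lambda>n. LINT z|lebesgue. ?F n z) \<longlonglongrightarrow> (LINT z|lebesgue. indicator (box a b) z *\<^sub>R g z)"
  proof (rule integral_dominated_convergence)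
    show "integrable lebesgue (\<lambda>z. norm (indicator (cbox a b) z *\<^sub>R g z))"
      by (intro integrable_norm int)
    have "set_integrable lebesgue (box a b) g"
      by (rule set_integrable_subset[of _ "cbox a b"])
        (use int box_subset_cbox in \<open>auto simp: set_integrable_def\<close>)
    then show "(\<lambda>z. indicator (box a b) z *\<^sub>R g z) \<in> borel_measurable lebesgue"
      by (auto simp: set_integrable_def)
    have "set_integrable lebesgue \<Omega> (\<lambda>z. g z * bump a b (inverse (Suc n)) z)" for n
      by (intro locally_integrable_mult_C0 g bump_in_C0_infinity sub) auto
    then show "?F n \<in> borel_measurable lebesgue" for n
      by (auto simp: set_integrable_def)
    have "(\<lambda>n. ?F n z) \<longlonglongrightarrow> indicator \<Omega> z *\<^sub>R (g z * indicator (box a b) z)" for z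
      by (intro tendsto_intros bump_tendsto)
    moreover have "indicator \<Omega> z *\<^sub>R (g z * indicator (box a b) z) = indicator (box a b) z *\<^sub>R g z" for z
      using sub box_subset_cbox[of a b] by (auto simp: indicator_def)
    ultimately show "AE z in lebesgue. (\<lambda>n. ?F n z) \<longlonglongrightarrow> indicator (box a b) z *\<^sub>R g z"
      by simp
    have "norm (?F n z) \<le> norm (indicator (cbox a b) z *\<^sub>R g z)" for n z
    proof (cases "z \<in> cbox a b")
      case True
      with sub have "z \<in> \<Omega>" by auto
      with True norm_bump_le_1[of "inverse (Suc n)" a b z] show ?thesis
        by (simp add: norm_mult mult_left_le)
    next
      case False
      then have "bump a b (inverse (Suc n)) z = 0"
        by (auto simp: in_cbox_complex_iff bump_def flat_def)
      then show ?thesis by simp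
    qed
    then show "AE z in lebesgue. norm (?F n z) \<le> norm (indicator (cbox a b) z *\<^sub>R g z)" for n
      by simp
  qed
  moreover have "(LINT z|lebesgue. ?F n z) = 0" for n
    using zero[OF bump_in_C0_infinity[OF _ sub], of "inverse (Suc n)"]
    by (simp add: set_lebesgue_integral_def)
  ultimately show ?thesis
    by (simp add: set_lebesgue_integral_def LIMSEQ_const_iff)
qed

lemma sigma_finite_lebesgue: "sigma_finite_measure (lebesgue :: 'a::euclidean_space measure)"
proof -
  obtain A :: "'a set set" where A: "countable A" "A \<subseteq> sets lborel" "\<Union>A = space lborel"
      "\<And>a. a \<in> A \<Longrightarrow> emeasure lborel a \<noteq> \<infinity>"
    using sigma_finite_measure.sigma_finite_countable[OF sigma_finite_lborel[where 'a='a]]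
    by (elim exE conjE) (rule that, assumption+, erule bspec)
  show ?thesis
  proof
    have "a \<in> sets lborel" if "a \<in> A" for a
      using that A(2) by blast
    then have "a \<in> sets lebesgue \<and> emeasure lebesgue a \<noteq> \<infinity>" if "a \<in> A" for a
      using that A(4) by (metis emeasure_completion main_part sets_completionI_sets)
    then show "\<exists>A::'a set set. countable A \<and> A \<subseteq> sets lebesgue \<and> \<Union>A = space lebesgue \<and>
        (\<forall>a\<in>A. emeasure lebesgue a \<noteq> \<infinity>)"
      using A(1,3) unfolding space_completion by blast
  qed
qed

text \<open>Open boxes form an intersection-stable generator of the Borel sets, so vanishing
  integrals spread to all Borel sets by Dynkin's argument; \<open>total\<close> is what makes
  complements work. A Lebesgue set agrees with its Borel main part up to a null set.\<close>

lemma AE_eq_0_if_box_integrals_eq_0: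
  fixes f :: "'a::euclidean_space \<Rightarrow> 'b::{second_countable_topology, banach}"
  assumes f: "integrable lebesgue f"
    and box: "\<And>l u. (LINT z:box l u|lebesgue. f z) = 0"
    and total: "(LINT z|lebesgue. f z) = 0"
  shows "AE z in lebesgue. f z = 0"
proof (rule sigma_finite_measure.density_zero[OF sigma_finite_lebesgue f])
  have int: "set_integrable lebesgue A f" if "A \<in> sets lebesgue" for A
    unfolding set_integrable_def by (rule integrable_mult_indicator[OF that f])
  have "A \<in> sigma_sets UNIV (range (\<lambda>(a, b). box a b :: 'a set)) \<Longrightarrow> 
      A \<in> sets borel \<and> (LINT z:A|lebesgue. f z) = 0" for A
  proof (induction rule: sigma_sets_induct_disjoint[rotated 2, consumes 1, case_names basic empty compl union int pow])
    case (basic A)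
    then show ?case by (auto simp: box)
  next
    case empty
    then show ?case by (simp add: set_lebesgue_integral_def)
  next
    case (compl A)
    have "(LINT z:UNIV|lebesgue. f z) = (LINT z:UNIV - A|lebesgue. f z) + (LINT z:A|lebesgue. f z)"
      by (subst set_integral_Un[symmetric]) (use compl in \<open>auto intro!: int simp: Compl_eq_Diff_UNIV[symmetric] Un_commute\<close>)
    then show ?case
      using compl total sets.compl_sets[of A borel] by (simp add: set_lebesgue_integral_def)
  next
    case (union A)
    have "(LINT z:\<Union>(range A)|lebesgue. f z) = (\<Sum>i. LINT z:A i|lebesgue. f z)"
      by (rule lebesgue_integral_countable_add)
        (use union in \<open>auto intro!: int simp: disjoint_family_on_def\<close>)
    with union show ?case by auto
  next
    case int
    then show ?case by (auto simp: Int_stable_def box_Int_box)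
  qed auto
  then have borel: "(LINT z:A|lebesgue. f z) = 0" if "A \<in> sets borel" for A :: "'a set"
    using that by (simp add: borel_eq_box)
  fix A :: "'a set" assume A: "A \<in> sets lebesgue"
  have "AE z in lebesgue. z \<in> main_part lborel A \<longleftrightarrow> z \<in> A"
    by (rule AE_completion[OF AE_in_main_part[OF A]])
  then have "(LINT z:A|lebesgue. f z) = (LINT z:main_part lborel A|lebesgue. f z)"
    unfolding set_lebesgue_integral_def
    by (intro integral_cong_AE borel_measurable_integrable[OF int[OF A, unfolded set_integrable_def]]
      borel_measurable_integrable[OF int[unfolded set_integrable_def]])
      (use main_part_sets[OF A] in \<open>auto elim!: eventually_mono simp: indicator_def\<close>)
  then show "(LINT z:A|lebesgue. f z) = 0"
    using borel main_part_sets[OF A] by simp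
qed

lemma AE_eq_0_if_orthogonal_C0:
  assumes \<Omega>: "open \<Omega>" and g: "locally_integrable \<Omega> g"
    and zero: "\<And>\<phi>. \<phi> \<in> C0_infinity \<Omega> \<Longrightarrow> (LINT z:\<Omega>|lebesgue. g z * \<phi> z) = 0"
  shows "AE z in lebesgue. z \<in> \<Omega> \<longrightarrow> g z = 0"
proof -
  have box: "AE z in lebesgue. z \<in> cbox a b \<longrightarrow> g z = 0" if sub: "cbox a b \<subseteq> \<Omega>" for a b
  proof -
    have "set_integrable lebesgue (cbox a b) g"
      using g sub by (auto simp: locally_integrable_def)
    then have int: "set_integrable lebesgue (box a b) g"
      by (rule set_integrable_subset) (auto simp: box_subset_cbox)
    have "AE z in lebesgue. indicator (box a b) z *\<^sub>R g z = 0"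
    proof (rule AE_eq_0_if_box_integrals_eq_0)
      show "integrable lebesgue (\<lambda>z. indicator (box a b) z *\<^sub>R g z)"
        using int by (simp add: set_integrable_def)
      show "(LINT z|lebesgue. indicator (box a b) z *\<^sub>R g z) = 0"
        using set_integral_box_eq_0[OF g zero sub] by (simp add: set_lebesgue_integral_def)
      show "(LINT z:box l u|lebesgue. indicator (box a b) z *\<^sub>R g z) = 0" for l u
      proof -
        obtain c d where cd: "box l u \<inter> box a b = box c d"
          unfolding box_Int_box by blast
        \<comment> \<open>An empty open box may have a closed box that leaves
          \<open>\<Omega>\<close>, hence the case split; otherwise the closed box is the closure of
          the open one and stays in \<open>cbox a b\<close>.\<close>
        have "cbox c d \<subseteq> \<Omega> \<or> box c d = {}"
        proof (cases "box c d = {}")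
          case False
          have "closure (box c d) \<subseteq> cbox a b"
            using cd box_subset_cbox[of a b] by (intro closure_minimal) auto
          with False sub show ?thesis by (simp add: closure_box)
        qed simp
        then have "(LINT z:box c d|lebesgue. g z) = 0"
          using set_integral_box_eq_0[OF g zero] by (auto simp: set_lebesgue_integral_def)
        moreover have "indicator (box l u) z *\<^sub>R indicator (box a b) z *\<^sub>R g z
            = indicator (box c d) z *\<^sub>R g z" for z
          unfolding cd[symmetric] by (auto simp: indicator_def)
        ultimately show ?thesis by (simp only: set_lebesgue_integral_def)
      qed
    qed
    \<comment> \<open>The bumps only see open boxes; the frontier lost in this way is negligible,
      which lets closed boxes cover \<open>\<Omega>\<close> below.\<close>
    moreover have "AE z in lebesgue. z \<notin> cbox a b - box a b"
      by (rule AE_not_in) (simp add: negligible_iff_null_sets[symmetric] negligible_frontier_interval)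
    ultimately show ?thesis
      by eventually_elim (auto simp: indicator_def)
  qed
  obtain D where D: "countable D" "D \<subseteq> Pow \<Omega>" "\<And>X. X \<in> D \<Longrightarrow> \<exists>a b. X = cbox a b" "\<Union>D = \<Omega>"
    using open_countable_Union_open_cbox[OF \<Omega>] by metis
  have "AE z in lebesgue. \<forall>X\<in>D. z \<in> X \<longrightarrow> g z = 0"
    unfolding AE_ball_countable[OF D(1)] using D(2,3) box by blast
  then show ?thesis
    by eventually_elim (use D(4) in auto)
qed

text \<open>The difference of two candidates annihilates all test functions. This frees
  \<open>weak_partial\<close> and \<open>energy\<close> from the choice made by
  \<open>SOME\<close>.\<close>

lemma has_weak_partial_unique:
  assumes \<Omega>: "open \<Omega>" and "has_weak_partial \<Omega> v h g" "has_weak_partial \<Omega> v h g'"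
  shows "AE z in lebesgue. z \<in> \<Omega> \<longrightarrow> g z = g' z"
proof -
  have g: "locally_integrable \<Omega> g" and g': "locally_integrable \<Omega> g'"
    using assms by (auto simp: has_weak_partial_def)
  have "AE z in lebesgue. z \<in> \<Omega> \<longrightarrow> g z - g' z = 0"
  proof (rule AE_eq_0_if_orthogonal_C0[OF \<Omega>])
    show "locally_integrable \<Omega> (\<lambda>z. g z - g' z)"
      using g g' by (auto simp: locally_integrable_def intro!: set_integral_diff(1))
    fix \<phi> assume \<phi>: "\<phi> \<in> C0_infinity \<Omega>"
    have "(LINT z:\<Omega>|lebesgue. g z * \<phi> z) = (LINT z:\<Omega>|lebesgue. g' z * \<phi> z)"
      using assms(2,3) \<phi> by (simp add: has_weak_partial_def)
    then show "(LINT z:\<Omega>|lebesgue. (g z - g' z) * \<phi> z) = 0"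
      using set_integral_diff(2)[OF locally_integrable_mult_C0[OF g \<phi>] locally_integrable_mult_C0[OF g' \<phi>]]
      by (simp add: left_diff_distrib)
  qed
  then show ?thesis by simp
qed

subsection \<open>Change of variables in the plane\<close>

text \<open>The differentiable change of variables formula is applied in \<open>real^2\<close>,
  where determinants of matrices make sense; this identification carries it to the complex
  plane.\<close>

definition complex_of_vec :: "real^2 \<Rightarrow> complex" where
  "complex_of_vec x = Complex (x $ 1) (x $ 2)"

definition vec_of_complex :: "complex \<Rightarrow> real^2" where
  "vec_of_complex z = vector [Re z, Im z]"

lemma vec_complex_inverse [simp]:
  "complex_of_vec (vec_of_complex z) = z" "vec_of_complex (complex_of_vec x) = x"
  by (simp_all add: complex_of_vec_def vec_of_complex_def vec_eq_iff forall_2)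

lemma linear_complex_of_vec: "linear complex_of_vec"
  by (rule linearI) (simp_all add: complex_of_vec_def complex_eq_iff)

lemma linear_vec_of_complex: "linear vec_of_complex"
  by (rule linearI) (simp_all add: vec_of_complex_def vec_eq_iff forall_2)

lemma borel_measurable_complex_of_vec [measurable]: "complex_of_vec \<in> borel_measurable borel"
  by (intro borel_measurable_continuous_onI linear_continuous_on
      linear_complex_of_vec[THEN linear_conv_bounded_linear[THEN iffD1]])

lemma vimage_complex_of_vec_box:
  "complex_of_vec -` box l u = box (vec_of_complex l) (vec_of_complex u)"
  by (auto simp: in_box_complex_iff mem_box_cart forall_2 complex_of_vec_def vec_of_complex_def)

lemma emeasure_box_complex:
  assumes "Re l \<le> Re u" "Im l \<le> Im u"
  shows "emeasure lborel (box (vec_of_complex l) (vec_of_complex u)) = (Re u - Re l) * (Im u - Im l)"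
proof -
  have "axis 1 (1::real) \<noteq> (axis 2 1 :: real^2)"
    by (simp add: axis_eq_axis)
  with assms show ?thesis
    by (subst emeasure_lborel_box)
      (auto simp: Basis_vec_def UNIV_2 inner_axis vec_of_complex_def)
qed

text \<open>Lebesgue measure is characterised by its values on boxes, and boxes correspond to boxes
  of the same area.\<close>

lemma lborel_eq_distr_complex_of_vec: "lborel = distr lborel borel complex_of_vec"
proof (rule lborel_eqI)
  fix l u :: complex
  assume "\<And>b. b \<in> Basis \<Longrightarrow> l \<bullet> b \<le> u \<bullet> b"
  from this[of 1] this[of \<i>] have le: "Re l \<le> Re u" "Im l \<le> Im u"
    by (auto simp: Basis_complex_def)
  then show "emeasure (distr lborel borel complex_of_vec) (box l u) = (\<Prod>b\<in>Basis. (u - l) \<bullet> b)"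
    by (subst emeasure_distr)
      (auto simp: vimage_complex_of_vec_box emeasure_box_complex Basis_complex_def)
qed simp

text \<open>\<open>J\<close> is the Jacobian determinant, written out in real coordinates.
  Regularity is asked of \<open>f\<close>; for \<open>g\<close> continuity is enough, since it
  enters through measurability and compact images.\<close>

locale plane_diffeo =
  fixes f g :: "complex \<Rightarrow> complex" and f' :: "complex \<Rightarrow> complex \<Rightarrow> complex" and J :: "complex \<Rightarrow> real"
  assumes f_g [simp]: "f (g z) = z"
    and g_f [simp]: "g (f z) = z"
    and f_derivative: "(f has_derivative f' z) (at z)"
    and continuous_g: "continuous_on UNIV g"
    and J_eq: "J z = Re (f' z 1) * Im (f' z \<i>) - Im (f' z 1) * Re (f' z \<i>)"
    and J_pos: "J z > 0"
    and continuous_J: "continuous_on UNIV J"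
begin

lemma continuous_f: "continuous_on A f"
  using f_derivative by (auto intro: continuous_at_imp_continuous_on has_derivative_continuous)

lemma borel_measurable_f [measurable]: "f \<in> borel_measurable borel"
  and borel_measurable_g [measurable]: "g \<in> borel_measurable borel"
  and borel_measurable_J [measurable]: "J \<in> borel_measurable borel"
  by (simp_all add: borel_measurable_continuous_onI continuous_f continuous_g continuous_J)

lemma det_derivative:
  "det (matrix (\<lambda>h. vec_of_complex (f' z (complex_of_vec h)))) = J z"
proof -
  have "complex_of_vec (axis 1 1) = 1" "complex_of_vec (axis 2 1) = \<i>"
    by (auto simp: complex_of_vec_def complex_eq_iff axis_def)
  then show ?thesis
    by (simp add: det_2 matrix_def J_eq vec_of_complex_def)
qed

lemma nn_integral_J_vimage_box:
  assumes le: "Re l \<le> Re u" "Im l \<le> Im u"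
  shows "(\<integral>\<^sup>+z. ennreal (J z) * indicator (f -` box l u) z \<partial>lborel) = (Re u - Re l) * (Im u - Im l)"
proof -
  define S where "S = f -` box l u"
  define F where "F x = vec_of_complex (f (complex_of_vec x))" for x
  define m where "m = (Re u - Re l) * (Im u - Im l)"
  have "open S"
    unfolding S_def by (rule open_vimage[OF open_box continuous_f])
  then have [measurable]: "S \<in> sets borel" by simp
  have S': "complex_of_vec -` S \<in> sets lebesgue"
    using measurable_sets[OF borel_measurable_complex_of_vec, of S] \<open>open S\<close> by simp
  have img: "F ` (complex_of_vec -` S) = box (vec_of_complex l) (vec_of_complex u)"
  proof -
    have "x \<in> F ` (complex_of_vec -` S)" if "complex_of_vec x \<in> box l u" for x
      by (rule image_eqI[of _ _ "vec_of_complex (g (complex_of_vec x))"])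
        (use that in \<open>auto simp: F_def S_def\<close>)
    then show ?thesis
      by (auto simp: vimage_complex_of_vec_box[symmetric] F_def S_def)
  qed
  have der: "(F has_derivative (\<lambda>h. vec_of_complex (f' (complex_of_vec x) (complex_of_vec h)))) (at x within A)" for x A
  proof -
    have "((\<lambda>x. f (complex_of_vec x)) has_derivative (\<lambda>h. f' (complex_of_vec x) (complex_of_vec h))) (at x within A)"
      by (rule has_derivative_compose[OF linear_imp_has_derivative[OF linear_complex_of_vec] f_derivative])
    from bounded_linear.has_derivative[OF linear_conv_bounded_linear[THEN iffD1, OF linear_vec_of_complex] this]
    show ?thesis by (simp add: F_def[abs_def])
  qed
  have inj: "inj_on F A" for A
    by (rule inj_on_inverseI[of _ "\<lambda>y. vec_of_complex (g (complex_of_vec y))"]) (simp add: F_def)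
  have "emeasure lborel (box (vec_of_complex l) (vec_of_complex u)) = ennreal m"
    by (simp only: emeasure_box_complex[OF le] m_def)
  moreover have "m \<ge> 0" using le by (simp add: m_def)
  ultimately have "F ` (complex_of_vec -` S) \<in> lmeasurable \<and> measure lebesgue (F ` (complex_of_vec -` S)) = m"
    unfolding img by (auto simp: measure_def)
  \<comment> \<open>The area of the image is known, because the image is a box; the formula for
    areas of injective differentiable images is read as a statement about the integral of the
    Jacobian.\<close>
  then have "((\<lambda>x. \<bar>J (complex_of_vec x)\<bar>) has_integral m) (complex_of_vec -` S)"
    unfolding has_measure_differentiable_image[OF S' der inj] det_derivative .
  then have "((\<lambda>x. J (complex_of_vec x)) has_integral m) (complex_of_vec -` S)"
    by (simp add: abs_of_pos[OF J_pos])
  from nn_integral_has_integral_lebesgue'[OF _ this] J_pos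
  have "(\<integral>\<^sup>+x. ennreal (J (complex_of_vec x)) * indicator S (complex_of_vec x) \<partial>lborel) = m"
    by (simp add: less_imp_le indicator_vimage)
  then have "(\<integral>\<^sup>+z. ennreal (J z) * indicator S z \<partial>distr lborel borel complex_of_vec) = m"
    by (subst nn_integral_distr) auto
  then show ?thesis
    by (simp add: S_def m_def lborel_eq_distr_complex_of_vec[symmetric])
qed

text \<open>The change of variables formula as an identity of measures; it suffices to compare them
  on boxes.\<close>

lemma lborel_eq_distr: "lborel = distr (density lborel J) borel f"
proof (rule lborel_eqI)
  fix l u :: complex
  assume "\<And>b. b \<in> Basis \<Longrightarrow> l \<bullet> b \<le> u \<bullet> b"
  from this[of 1] this[of \<i>] have le: "Re l \<le> Re u" "Im l \<le> Im u"
    by (auto simp: Basis_complex_def)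
  have [measurable]: "f -` box l u \<in> sets borel"
    using measurable_sets[OF borel_measurable_f, of "box l u"] by simp
  show "emeasure (distr (density lborel J) borel f) (box l u) = (\<Prod>b\<in>Basis. (u - l) \<bullet> b)"
    by (simp add: emeasure_distr emeasure_density nn_integral_J_vimage_box[OF le] Basis_complex_def)
qed simp

lemma lebesgue_measurable_f [measurable]: "f \<in> lebesgue \<rightarrow>\<^sub>M lebesgue"
  and lebesgue_eq_distr: "lebesgue = distr (density lebesgue J) lebesgue f"
proof -
  define C where "C = completion (density lborel J)"
  \<comment> \<open>Because \<open>J\<close> is positive, weighting by \<open>J\<close> keeps the
    null sets, so weighting and completion commute.\<close>
  have C: "C = density lebesgue J"
    unfolding C_def by (rule completion_density_eq) (auto simp: J_pos)
  have "distr C lborel f = distr C borel f"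
    by (rule distr_cong) simp_all
  also have "\<dots> = distr (density lborel J) borel f"
    unfolding C_def by (rule distr_completion) simp
  finally have distr: "distr C lborel f = lborel"
    using lborel_eq_distr by simp
  have meas: "f \<in> C \<rightarrow>\<^sub>M lborel"
    unfolding C_def by (rule measurable_completion) simp
  interpret complete_measure C
    unfolding C_def by (rule completion.complete_measure_axioms)
  have "f \<in> C \<rightarrow>\<^sub>M lebesgue"
    by (rule measurable_completion2[OF meas]) (simp add: distr)
  then show "f \<in> lebesgue \<rightarrow>\<^sub>M lebesgue"
    by (simp add: C measurable_def)
  show "lebesgue = distr (density lebesgue J) lebesgue f"
    using completion_distr_eq[OF meas, unfolded distr, OF refl] unfolding C .
qed

text \<open>Borel measurability passes to the completion once preimages of null sets are null: the
  measure of the preimage of \<open>N\<close> under \<open>g\<close> is the integral of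
  \<open>J\<close> over \<open>N\<close>.\<close>

lemma lebesgue_measurable_g [measurable]: "g \<in> lebesgue \<rightarrow>\<^sub>M lebesgue"
proof (rule completion.measurable_completion2)
  show "g \<in> lebesgue \<rightarrow>\<^sub>M lborel"
    by (simp add: measurable_completion)
  show "null_sets lborel \<subseteq> null_sets (distr lebesgue lborel g)"
  proof
    fix N assume N: "N \<in> null_sets (lborel :: complex measure)"
    then have [measurable]: "N \<in> sets borel" by auto
    have gN: "g -` N \<in> sets borel"
      using measurable_sets[OF borel_measurable_g, of N] by simp
    have "f -` (g -` N) = N" by auto
    then have "emeasure lborel (g -` N) = emeasure (density lborel J) N"
      using gN by (subst lborel_eq_distr) (simp add: emeasure_distr)
    also have "\<dots> = 0"
      using N by (simp add: emeasure_density nn_integral_null_set)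
    finally have "emeasure lebesgue (g -` N) = 0"
      using gN by simp
    then show "N \<in> null_sets (distr lebesgue lborel g)"
      by (simp add: null_sets_def emeasure_distr measurable_completion)
  qed
qed

lemma
  fixes u :: "complex \<Rightarrow> 'b::{banach, second_countable_topology}"
  assumes [measurable]: "u \<in> borel_measurable lebesgue"
  shows integrable_change_of_variables:
      "integrable lebesgue u \<longleftrightarrow> integrable lebesgue (\<lambda>z. J z *\<^sub>R u (f z))"
    and integral_change_of_variables:
      "(LINT z|lebesgue. u z) = (LINT z|lebesgue. J z *\<^sub>R u (f z))"
proof -
  have [measurable]: "J \<in> borel_measurable lebesgue"
    by (simp add: measurable_completion)
  have f: "f \<in> density lebesgue J \<rightarrow>\<^sub>M lebesgue" by simp
  have uf: "(\<lambda>z. u (f z)) \<in> borel_measurable lebesgue" by measurable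
  have J: "AE z in lebesgue. 0 \<le> J z" by (simp add: less_imp_le J_pos)
  show "integrable lebesgue u \<longleftrightarrow> integrable lebesgue (\<lambda>z. J z *\<^sub>R u (f z))"
    by (subst lebesgue_eq_distr) (simp add: integrable_distr_eq[OF f assms] integrable_density[OF uf _ J])
  show "(LINT z|lebesgue. u z) = (LINT z|lebesgue. J z *\<^sub>R u (f z))"
    by (subst lebesgue_eq_distr) (simp add: integral_distr[OF f assms] integral_density[OF uf _ J])
qed

end

subsection \<open>Square integrable functions and weak derivatives\<close>

lemma lebesgue_measurable_continuous:
  fixes f :: "'a::euclidean_space \<Rightarrow> 'b::topological_space"
  shows "continuous_on UNIV f \<Longrightarrow> f \<in> borel_measurable lebesgue"
  by (simp add: borel_measurable_continuous_onI measurable_completion)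

text \<open>Completeness of Lebesgue measure: preimages that differ by a null set are measurable
  together. It supplies measurability of representatives obtained by choice.\<close>

lemma borel_measurable_lebesgue_AE_cong:
  fixes u w :: "'a::euclidean_space \<Rightarrow> 'b::topological_space"
  assumes u: "u \<in> borel_measurable lebesgue" and eq: "AE z in lebesgue. u z = w z"
  shows "w \<in> borel_measurable lebesgue"
proof (rule measurableI)
  fix A :: "'b set" assume "A \<in> sets borel"
  then have "u -` A \<inter> space lebesgue \<in> sets lebesgue"
    using u by (rule measurable_sets[rotated])
  moreover have "AE z in lebesgue. z \<in> u -` A \<inter> space lebesgue \<longleftrightarrow> z \<in> w -` A \<inter> space lebesgue"
    using eq by eventually_elim auto
  ultimately show "w -` A \<inter> space lebesgue \<in> sets lebesgue"
    by (metis completion.in_sets_AE Int_lower2)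
qed simp

lemma L2_AE_cong:
  assumes u: "L2 \<Omega> u" and eq: "AE z in lebesgue. z \<in> \<Omega> \<longrightarrow> u z = w z"
  shows "L2 \<Omega> w"
proof -
  have "set_borel_measurable lebesgue \<Omega> w"
    using u unfolding L2_def set_borel_measurable_def
    by (elim conjE borel_measurable_lebesgue_AE_cong) (use eq in \<open>auto elim!: eventually_mono simp: indicator_def\<close>)
  moreover have "set_integrable lebesgue \<Omega> (\<lambda>z. (cmod (w z))\<^sup>2)"
    unfolding set_integrable_def
  proof (rule integrable_cong_AE_imp)
    show "integrable lebesgue (\<lambda>z. indicator \<Omega> z *\<^sub>R (cmod (u z))\<^sup>2)"
      using u by (simp add: L2_def set_integrable_def)
    have "(\<lambda>z. (cmod (indicator \<Omega> z *\<^sub>R w z))\<^sup>2) \<in> borel_measurable lebesgue"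
      using \<open>set_borel_measurable lebesgue \<Omega> w\<close> unfolding set_borel_measurable_def by measurable
    also have "(\<lambda>z. (cmod (indicator \<Omega> z *\<^sub>R w z))\<^sup>2) = (\<lambda>z. indicator \<Omega> z *\<^sub>R (cmod (w z))\<^sup>2)"
      by (auto simp: indicator_def)
    finally show "(\<lambda>z. indicator \<Omega> z *\<^sub>R (cmod (w z))\<^sup>2) \<in> borel_measurable lebesgue" .
    show "AE z in lebesgue. indicator \<Omega> z *\<^sub>R (cmod (u z))\<^sup>2 = indicator \<Omega> z *\<^sub>R (cmod (w z))\<^sup>2"
      using eq by eventually_elim (auto simp: indicator_def)
  qed
  ultimately show ?thesis by (simp add: L2_def)
qed

lemma set_integrable_bound_L2:
  fixes w :: "complex \<Rightarrow> 'b::{banach, second_countable_topology}"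
  assumes "set_borel_measurable lebesgue \<Omega> w" "L2 \<Omega> u" "L2 \<Omega> v"
    and bound: "\<And>z. z \<in> \<Omega> \<Longrightarrow> norm (w z) \<le> C * ((cmod (u z))\<^sup>2 + (cmod (v z))\<^sup>2)"
  shows "set_integrable lebesgue \<Omega> w"
proof -
  have "set_integrable lebesgue \<Omega> (\<lambda>z. C * ((cmod (u z))\<^sup>2 + (cmod (v z))\<^sup>2))"
    using assms by (intro set_integrable_mult_right set_integral_add) (auto simp: L2_def)
  then show ?thesis
    unfolding set_integrable_def
    by (rule Bochner_Integration.integrable_bound)
      (use assms(1) bound in \<open>auto simp: set_borel_measurable_def indicator_def intro: order_trans[OF _ abs_ge_self]\<close>)
qed

lemma L2_add:
  assumes "L2 \<Omega> u" "L2 \<Omega> v"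
  shows "L2 \<Omega> (\<lambda>z. u z + v z)"
proof -
  have [measurable]: "(\<lambda>z. indicator \<Omega> z *\<^sub>R u z) \<in> borel_measurable lebesgue"
      "(\<lambda>z. indicator \<Omega> z *\<^sub>R v z) \<in> borel_measurable lebesgue"
    using assms by (auto simp: L2_def set_borel_measurable_def)
  have m: "set_borel_measurable lebesgue \<Omega> (\<lambda>z. u z + v z)"
    unfolding set_borel_measurable_def scaleR_add_right by measurable
  have "(\<lambda>z. (cmod (indicator \<Omega> z *\<^sub>R u z + indicator \<Omega> z *\<^sub>R v z))\<^sup>2) \<in> borel_measurable lebesgue"
    by measurable
  also have "(\<lambda>z. (cmod (indicator \<Omega> z *\<^sub>R u z + indicator \<Omega> z *\<^sub>R v z))\<^sup>2)
      = (\<lambda>z. indicator \<Omega> z *\<^sub>R (cmod (u z + v z))\<^sup>2)"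
    by (auto simp: indicator_def)
  finally have m2: "set_borel_measurable lebesgue \<Omega> (\<lambda>z. (cmod (u z + v z))\<^sup>2)"
    by (simp add: set_borel_measurable_def)
  have "(cmod (a + b))\<^sup>2 \<le> 2 * ((cmod a)\<^sup>2 + (cmod b)\<^sup>2)" for a b
  proof -
    \<comment> \<open>The parallelogram law; dropping the second square gives the bound.\<close>
    have "(cmod (a + b))\<^sup>2 + (cmod (a - b))\<^sup>2 = 2 * ((cmod a)\<^sup>2 + (cmod b)\<^sup>2)"
      unfolding cmod_power2 by (simp add: power2_eq_square algebra_simps)
    then show ?thesis by (smt (verit) zero_le_power2)
  qed
  then have "set_integrable lebesgue \<Omega> (\<lambda>z. (cmod (u z + v z))\<^sup>2)"
    by (intro set_integrable_bound_L2[OF m2 assms, of 2]) simp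
  with m show ?thesis by (simp add: L2_def)
qed

lemma set_borel_measurable_mult_continuous:
  fixes a u :: "complex \<Rightarrow> complex"
  assumes "set_borel_measurable lebesgue \<Omega> u" "continuous_on UNIV a"
  shows "set_borel_measurable lebesgue \<Omega> (\<lambda>z. u z * a z)"
proof -
  have [measurable]: "(\<lambda>z. indicator \<Omega> z *\<^sub>R u z) \<in> borel_measurable lebesgue"
      "a \<in> borel_measurable lebesgue"
    using assms by (auto simp: set_borel_measurable_def lebesgue_measurable_continuous)
  have "(\<lambda>z. (indicator \<Omega> z *\<^sub>R u z) * a z) \<in> borel_measurable lebesgue"
    by measurable
  then show ?thesis
    by (simp add: set_borel_measurable_def)
qed

lemma L2_mult_bounded:
  assumes u: "L2 \<Omega> u" and a: "continuous_on UNIV a" and B: "\<And>z. cmod (a z) \<le> B"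
  shows "L2 \<Omega> (\<lambda>z. u z * a z)"
proof -
  have m: "set_borel_measurable lebesgue \<Omega> (\<lambda>z. u z * a z)"
    using u a by (intro set_borel_measurable_mult_continuous) (auto simp: L2_def)
  then have "(\<lambda>z. (cmod (indicator \<Omega> z *\<^sub>R (u z * a z)))\<^sup>2) \<in> borel_measurable lebesgue"
    unfolding set_borel_measurable_def by measurable
  also have "(\<lambda>z. (cmod (indicator \<Omega> z *\<^sub>R (u z * a z)))\<^sup>2)
      = (\<lambda>z. indicator \<Omega> z *\<^sub>R (cmod (u z * a z))\<^sup>2)"
    by (auto simp: indicator_def)
  finally have m2: "set_borel_measurable lebesgue \<Omega> (\<lambda>z. (cmod (u z * a z))\<^sup>2)"
    by (simp add: set_borel_measurable_def)
  have "(cmod (u z * a z))\<^sup>2 \<le> B\<^sup>2 * ((cmod (u z))\<^sup>2 + (cmod (u z))\<^sup>2)" for z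
  proof -
    have "(cmod (a z))\<^sup>2 \<le> B\<^sup>2" by (rule power_mono) (use B in auto)
    then have "(cmod (u z))\<^sup>2 * (cmod (a z))\<^sup>2 \<le> (cmod (u z))\<^sup>2 * B\<^sup>2"
      by (rule mult_left_mono) simp
    also have "\<dots> \<le> B\<^sup>2 * ((cmod (u z))\<^sup>2 + (cmod (u z))\<^sup>2)"
      by (simp add: algebra_simps)
    finally show ?thesis by (simp add: norm_mult power_mult_distrib)
  qed
  then have "set_integrable lebesgue \<Omega> (\<lambda>z. (cmod (u z * a z))\<^sup>2)"
    by (intro set_integrable_bound_L2[OF m2 u u]) simp
  with m show ?thesis by (simp add: L2_def)
qed

lemma L2_locally_integrable:
  assumes u: "L2 \<Omega> u"
  shows "locally_integrable \<Omega> u"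
  unfolding locally_integrable_def
proof (intro allI impI, elim conjE)
  fix K assume K: "compact K" "K \<subseteq> \<Omega>"
  have Kl: "K \<in> lmeasurable" by (rule lmeasurable_compact[OF K(1)])
  have m: "(\<lambda>z. indicator \<Omega> z *\<^sub>R u z) \<in> borel_measurable lebesgue"
    using u by (simp add: L2_def set_borel_measurable_def)
  have "(\<lambda>z. indicator K z *\<^sub>R (indicator \<Omega> z *\<^sub>R u z)) \<in> borel_measurable lebesgue"
    using Kl by (intro borel_measurable_scaleR[OF _ m] borel_measurable_indicator) auto
  also have "(\<lambda>z. indicator K z *\<^sub>R (indicator \<Omega> z *\<^sub>R u z)) = (\<lambda>z. indicator K z *\<^sub>R u z)"
    using K by (fastforce simp: indicator_def)
  finally have m': "(\<lambda>z. indicator K z *\<^sub>R u z) \<in> borel_measurable lebesgue" .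
  show "set_integrable lebesgue K u"
    unfolding set_integrable_def
  proof (rule Bochner_Integration.integrable_bound[OF _ m'])
    show "integrable lebesgue (\<lambda>z. indicator K z + indicator \<Omega> z *\<^sub>R (cmod (u z))\<^sup>2)"
      using u Kl by (intro Bochner_Integration.integrable_add)
        (auto simp: L2_def set_integrable_def fmeasurable_def integrable_indicator_iff)
    \<comment> \<open>On a compact set, which has finite measure, the constant \<open>1\<close> is
      integrable, so square integrability suffices.\<close>
    have "cmod (u z) \<le> 1 + (cmod (u z))\<^sup>2" for z
      using sum_squares_bound[of 1 "cmod (u z)"] norm_ge_zero[of "u z"]
      unfolding power2_eq_square by linarith
    then show "AE z in lebesgue. norm (indicator K z *\<^sub>R u z)
        \<le> norm (indicator K z + indicator \<Omega> z *\<^sub>R (cmod (u z))\<^sup>2)"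
      using K by (auto simp: indicator_def)
  qed
qed

text \<open>\<open>SOME\<close> picks a weak derivative without asking for square integrability.
  That property is inherited from the witness in \<open>W12\<close> by uniqueness almost
  everywhere.\<close>

lemma W12_weak_partial:
  assumes \<Omega>: "open \<Omega>" and h: "h \<in> W12 \<Omega>" and v: "v \<in> {1, \<i>}"
  shows "has_weak_partial \<Omega> v h (weak_partial \<Omega> v h)" "L2 \<Omega> (weak_partial \<Omega> v h)"
proof -
  obtain g where g: "has_weak_partial \<Omega> v h g" "L2 \<Omega> g"
    using h v unfolding W12_def by blast
  show wp: "has_weak_partial \<Omega> v h (weak_partial \<Omega> v h)"
    unfolding weak_partial_def by (rule someI[of "has_weak_partial \<Omega> v h", OF g(1)])
  show "L2 \<Omega> (weak_partial \<Omega> v h)"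
    by (rule L2_AE_cong[OF g(2) has_weak_partial_unique[OF \<Omega> g(1) wp]])
qed

lemma set_integral_AE_cong:
  fixes u w :: "complex \<Rightarrow> real"
  assumes "set_integrable lebesgue \<Omega> u" and "AE z in lebesgue. z \<in> \<Omega> \<longrightarrow> u z = w z"
  shows "(LINT z:\<Omega>|lebesgue. u z) = (LINT z:\<Omega>|lebesgue. w z)"
proof -
  have u: "(\<lambda>z. indicator \<Omega> z *\<^sub>R u z) \<in> borel_measurable lebesgue"
    using assms(1) unfolding set_integrable_def by (rule borel_measurable_integrable)
  have eq: "AE z in lebesgue. indicator \<Omega> z *\<^sub>R u z = indicator \<Omega> z *\<^sub>R w z"
    using assms(2) by (auto elim!: eventually_mono simp: indicator_def)
  show ?thesis
    unfolding set_lebesgue_integral_def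
    by (rule integral_cong_AE[OF u borel_measurable_lebesgue_AE_cong[OF u eq] eq])
qed

lemma parallelogram_partials:
  "(cmod ((a - \<i> * b) / 2))\<^sup>2 + (cmod ((a + \<i> * b) / 2))\<^sup>2 = ((cmod a)\<^sup>2 + (cmod b)\<^sup>2) / 2"
  unfolding cmod_power2 by (simp add: power2_eq_square field_simps)

text \<open>Lets the energy be computed from any explicit weak derivatives, in particular from those
  given by the chain rule for the transported function.\<close>

lemma energy_eq:
  assumes \<Omega>: "open \<Omega>" and "has_weak_partial \<Omega> 1 h hx" "has_weak_partial \<Omega> \<i> h hy"
    and L2: "L2 \<Omega> hx" "L2 \<Omega> hy"
  shows "energy \<Omega> h = (LINT z:\<Omega>|lebesgue. ((cmod (hx z))\<^sup>2 + (cmod (hy z))\<^sup>2) / 2)"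
proof -
  have "AE z in lebesgue. z \<in> \<Omega> \<longrightarrow> hx z = weak_partial \<Omega> 1 h z"
    by (rule has_weak_partial_unique[OF \<Omega> assms(2)])
      (unfold weak_partial_def, rule someI[of "has_weak_partial \<Omega> 1 h"], rule assms)
  moreover have "AE z in lebesgue. z \<in> \<Omega> \<longrightarrow> hy z = weak_partial \<Omega> \<i> h z"
    by (rule has_weak_partial_unique[OF \<Omega> assms(3)])
      (unfold weak_partial_def, rule someI[of "has_weak_partial \<Omega> \<i> h"], rule assms)
  ultimately have "AE z in lebesgue. z \<in> \<Omega> \<longrightarrow> ((cmod (hx z))\<^sup>2 + (cmod (hy z))\<^sup>2) / 2
      = (cmod (weak_d_xi \<Omega> h z))\<^sup>2 + (cmod (weak_d_xibar \<Omega> h z))\<^sup>2"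
    unfolding weak_d_xi_def weak_d_xibar_def parallelogram_partials by eventually_elim auto
  moreover have "set_integrable lebesgue \<Omega> (\<lambda>z. ((cmod (hx z))\<^sup>2 + (cmod (hy z))\<^sup>2) / 2)"
    using L2 by (intro set_integrable_divide set_integral_add) (auto simp: L2_def)
  ultimately show ?thesis
    unfolding energy_def by (intro set_integral_AE_cong[symmetric])
qed

subsection \<open>Sobolev functions under a diffeomorphism of the domain\<close>

text \<open>The uniform bounds \<open>M\<close> and \<open>c\<close> make multiplication by
  cofactors and by \<open>1 / J\<close> preserve \<open>L2\<close>; invariance of
  \<open>\<Omega>\<close> turns the indicator of \<open>\<Omega>\<close> composed with
  \<open>f\<close> back into itself.\<close>

locale domain_diffeo = plane_diffeo f g "\<lambda>z v. partial v f z" J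
  for f g J +
  fixes \<Omega> :: "complex set" and M c :: real
  assumes open_domain: "open \<Omega>"
    and smooth_f: "smooth f"
    and f_in_domain_iff [simp]: "f z \<in> \<Omega> \<longleftrightarrow> z \<in> \<Omega>"
    and partial_bound: "cmod (partial 1 f z) \<le> M" "cmod (partial \<i> f z) \<le> M"
    and c_pos: "c > 0"
    and J_bound: "J z \<ge> c"
begin

lemma J_upper_bound: "J z \<le> 2 * M\<^sup>2"
proof -
  have "\<bar>Re (partial 1 f z)\<bar> \<le> M" "\<bar>Im (partial 1 f z)\<bar> \<le> M"
       "\<bar>Re (partial \<i> f z)\<bar> \<le> M" "\<bar>Im (partial \<i> f z)\<bar> \<le> M"
    using partial_bound[of z] abs_Re_le_cmod abs_Im_le_cmod order_trans by blast+
  then have "\<bar>Re (partial 1 f z) * Im (partial \<i> f z)\<bar> \<le> M * M"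
      "\<bar>Im (partial 1 f z) * Re (partial \<i> f z)\<bar> \<le> M * M"
    unfolding abs_mult by (auto intro!: mult_mono order_trans[OF abs_ge_zero])
  then show ?thesis
    unfolding J_eq power2_eq_square by linarith
qed

lemma set_integral_change_of_variables:
  fixes u :: "complex \<Rightarrow> 'b::{banach, second_countable_topology}"
  assumes "set_borel_measurable lebesgue \<Omega> u"
  shows "set_integrable lebesgue \<Omega> u \<longleftrightarrow> set_integrable lebesgue \<Omega> (\<lambda>z. J z *\<^sub>R u (f z))"
    and "(LINT z:\<Omega>|lebesgue. u z) = (LINT z:\<Omega>|lebesgue. J z *\<^sub>R u (f z))"
  using integrable_change_of_variables[of "\<lambda>z. indicator \<Omega> z *\<^sub>R u z"]
    integral_change_of_variables[of "\<lambda>z. indicator \<Omega> z *\<^sub>R u z"] assms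
  by (simp_all add: set_borel_measurable_def set_integrable_def set_lebesgue_integral_def
      indicator_def[of \<Omega>] mult.commute)

lemma set_borel_measurable_transport:
  fixes u :: "complex \<Rightarrow> 'b::real_normed_vector"
  assumes u: "set_borel_measurable lebesgue \<Omega> u" and w: "\<And>z. z \<in> \<Omega> \<Longrightarrow> w (f z) = u z"
  shows "set_borel_measurable lebesgue \<Omega> w"
proof -
  have "indicator \<Omega> z *\<^sub>R w z = indicator \<Omega> (g z) *\<^sub>R u (g z)" for z
    using w[of "g z"] f_in_domain_iff[of "g z"] by (auto simp: indicator_def)
  moreover have "(\<lambda>z. indicator \<Omega> (g z) *\<^sub>R u (g z)) \<in> borel_measurable lebesgue"
    using measurable_compose[OF lebesgue_measurable_g, of "\<lambda>z. indicator \<Omega> z *\<^sub>R u z"] u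
    by (simp add: set_borel_measurable_def)
  ultimately show ?thesis by (simp add: set_borel_measurable_def)
qed

text \<open>After the change of variables the squared modulus carries the weight \<open>J\<close>,
  which is at most \<open>2 * M\<^sup>2\<close>. Stating the relation as
  \<open>w (f z) = u z\<close> on \<open>\<Omega>\<close> leaves \<open>w\<close> free
  elsewhere.\<close>

lemma L2_transport:
  assumes u: "L2 \<Omega> u" and w: "\<And>z. z \<in> \<Omega> \<Longrightarrow> w (f z) = u z"
  shows "L2 \<Omega> w"
proof -
  have m: "set_borel_measurable lebesgue \<Omega> w"
    by (rule set_borel_measurable_transport[where u = u and w = w]) (use u w in \<open>simp_all add: L2_def\<close>)
  have sq: "set_borel_measurable lebesgue \<Omega> (\<lambda>z. (cmod (u z))\<^sup>2)"
    using u by (auto simp: L2_def set_integrable_def set_borel_measurable_def)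
  have m2: "set_borel_measurable lebesgue \<Omega> (\<lambda>z. (cmod (w z))\<^sup>2)"
    by (rule set_borel_measurable_transport[OF sq]) (simp add: w)
  have J: "J \<in> borel_measurable lebesgue"
    by (rule lebesgue_measurable_continuous[OF continuous_J])
  have "set_integrable lebesgue \<Omega> (\<lambda>z. J z *\<^sub>R (cmod (u z))\<^sup>2)"
  proof (rule set_integrable_bound_L2[OF _ u u])
    have "(\<lambda>z. J z * (indicator \<Omega> z *\<^sub>R (cmod (u z))\<^sup>2)) \<in> borel_measurable lebesgue"
      using sq J unfolding set_borel_measurable_def by (intro borel_measurable_times)
    then show "set_borel_measurable lebesgue \<Omega> (\<lambda>z. J z *\<^sub>R (cmod (u z))\<^sup>2)"
      by (simp add: set_borel_measurable_def algebra_simps)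
    show "norm (J z *\<^sub>R (cmod (u z))\<^sup>2) \<le> M\<^sup>2 * ((cmod (u z))\<^sup>2 + (cmod (u z))\<^sup>2)" for z
      using mult_right_mono[OF J_upper_bound[of z], of "(cmod (u z))\<^sup>2"] J_pos[of z]
      by (simp add: abs_mult algebra_simps)
  qed
  also have "?this \<longleftrightarrow> set_integrable lebesgue \<Omega> (\<lambda>z. J z *\<^sub>R (cmod (w (f z)))\<^sup>2)"
    unfolding set_integrable_def
    by (rule Bochner_Integration.integrable_cong) (auto simp: indicator_def w)
  also have "\<dots> \<longleftrightarrow> set_integrable lebesgue \<Omega> (\<lambda>z. (cmod (w z))\<^sup>2)"
    by (rule set_integral_change_of_variables(1)[OF m2, symmetric])
  finally show ?thesis
    using m by (simp add: L2_def)
qed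

lemma C0_infinity_compose:
  assumes "\<phi> \<in> C0_infinity \<Omega>"
  shows "(\<lambda>z. \<phi> (f z)) \<in> C0_infinity \<Omega>"
  using assms
proof (rule C0_infinityE)
  fix K assume K: "smooth \<phi>" "compact K" "K \<subseteq> \<Omega>" "\<And>z. z \<notin> K \<Longrightarrow> \<phi> z = 0"
  show ?thesis
  proof (rule C0_infinityI)
    show "smooth (\<lambda>z. \<phi> (f z))" by (rule smooth_compose[OF K(1) smooth_f])
    show "compact (g ` K)"
      by (rule compact_continuous_image[OF continuous_on_subset[OF continuous_g] K(2)]) simp
    show "g ` K \<subseteq> \<Omega>"
    proof
      fix z assume "z \<in> g ` K"
      then obtain x where "x \<in> K" "z = g x" by blast
      with K(3) f_in_domain_iff[of z] show "z \<in> \<Omega>" by auto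
    qed
    show "\<phi> (f z) = 0" if "z \<notin> g ` K" for z
      using that K(4)[of "f z"] by (metis g_f imageI)
  qed
qed

text \<open>Both coordinate directions at once: the pair \<open>\<alpha>\<close>,
  \<open>\<beta>\<close> stands for one cofactor row. By \<open>piola\<close> the pulled back
  integrand is \<open>h\<close> times a divergence of test functions; the weak derivatives of
  \<open>h\<close> take over, and \<open>G\<close> is what remains after division by
  \<open>J\<close> and the return change of variables.\<close>

lemma has_weak_partial_transport:
  fixes h hx hy \<alpha> \<beta> H G :: "complex \<Rightarrow> complex"
  assumes h: "L2 \<Omega> h" and hx: "has_weak_partial \<Omega> 1 h hx" "L2 \<Omega> hx"
    and hy: "has_weak_partial \<Omega> \<i> h hy" "L2 \<Omega> hy"
    and \<alpha>: "smooth \<alpha>" "\<And>z. cmod (\<alpha> z) \<le> B" and \<beta>: "smooth \<beta>" "\<And>z. cmod (\<beta> z) \<le> B"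
    and piola: "\<And>\<phi> z. smooth \<phi> \<Longrightarrow> J z * partial v \<phi> (f z) =
       partial 1 (\<lambda>z. \<phi> (f z) * \<alpha> z) z + partial \<i> (\<lambda>z. \<phi> (f z) * \<beta> z) z"
    and H: "\<And>z. z \<in> \<Omega> \<Longrightarrow> H (f z) = h z"
    and G: "\<And>z. z \<in> \<Omega> \<Longrightarrow> G (f z) = (hx z * \<alpha> z + hy z * \<beta> z) / J z"
  shows "has_weak_partial \<Omega> v H G" "L2 \<Omega> G"
proof -
  have H_L2: "L2 \<Omega> H" by (rule L2_transport[OF h H])
  have J_nz: "J z \<noteq> 0" for z
    using J_pos[of z] by simp
  then have J_inv: "continuous_on UNIV (\<lambda>z. inverse (complex_of_real (J z)))"
    by (intro continuous_intros continuous_J) auto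
  have J_inv_bound: "cmod (inverse (complex_of_real (J z))) \<le> inverse c" for z
    using le_imp_inverse_le[OF J_bound[of z] c_pos] J_pos[of z]
    by (simp add: norm_inverse)
  have "L2 \<Omega> (\<lambda>z. (hx z * \<alpha> z + hy z * \<beta> z) * inverse (complex_of_real (J z)))"
    by (intro L2_mult_bounded[OF _ J_inv J_inv_bound] L2_add L2_mult_bounded[OF hx(2) smooth_continuous[OF \<alpha>(1)] \<alpha>(2)]
        L2_mult_bounded[OF hy(2) smooth_continuous[OF \<beta>(1)] \<beta>(2)])
  then show G_L2: "L2 \<Omega> G"
    by (rule L2_transport) (simp add: G divide_inverse)
  show "has_weak_partial \<Omega> v H G"
    unfolding has_weak_partial_def
  proof (intro conjI ballI L2_locally_integrable H_L2 G_L2)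
    fix \<phi> assume \<phi>: "\<phi> \<in> C0_infinity \<Omega>"
    define \<psi> where "\<psi> z = \<phi> (f z)" for z
    have \<psi>: "\<psi> \<in> C0_infinity \<Omega>"
      using C0_infinity_compose[OF \<phi>] by (simp add: \<psi>_def[abs_def])
    have \<psi>\<alpha>: "(\<lambda>z. \<psi> z * \<alpha> z) \<in> C0_infinity \<Omega>" and \<psi>\<beta>: "(\<lambda>z. \<psi> z * \<beta> z) \<in> C0_infinity \<Omega>"
      by (intro C0_infinity_mult \<psi> \<alpha> \<beta>)+
    have li: "locally_integrable \<Omega> h" "locally_integrable \<Omega> hx" "locally_integrable \<Omega> hy"
      by (intro L2_locally_integrable h hx hy)+
    have meas: "set_borel_measurable lebesgue \<Omega> (\<lambda>z. u z * \<theta> z)"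
      if "L2 \<Omega> u" "\<theta> \<in> C0_infinity \<Omega>" for u \<theta>
      using that by (intro set_borel_measurable_mult_continuous smooth_continuous C0_infinity_smooth)
        (auto simp: L2_def)
    have "(LINT z:\<Omega>|lebesgue. H z * partial v \<phi> z)
        = (LINT z:\<Omega>|lebesgue. J z *\<^sub>R (H (f z) * partial v \<phi> (f z)))"
      by (rule set_integral_change_of_variables(2)[OF meas[OF H_L2 C0_infinity_partial[OF \<phi>]]])
    also have "\<dots> = (LINT z:\<Omega>|lebesgue. h z * partial 1 (\<lambda>z. \<psi> z * \<alpha> z) z
        + h z * partial \<i> (\<lambda>z. \<psi> z * \<beta> z) z)"
    proof (rule set_lebesgue_integral_cong)
      show "\<Omega> \<in> sets lebesgue" using open_domain by simp
      show "\<forall>z. z \<in> \<Omega> \<longrightarrow> J z *\<^sub>R (H (f z) * partial v \<phi> (f z))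
          = h z * partial 1 (\<lambda>z. \<psi> z * \<alpha> z) z + h z * partial \<i> (\<lambda>z. \<psi> z * \<beta> z) z"
        unfolding \<psi>_def distrib_left[symmetric] piola[OF C0_infinity_smooth[OF \<phi>], symmetric]
        by (simp add: H scaleR_conv_of_real)
    qed
    also have "\<dots> = (LINT z:\<Omega>|lebesgue. h z * partial 1 (\<lambda>z. \<psi> z * \<alpha> z) z)
        + (LINT z:\<Omega>|lebesgue. h z * partial \<i> (\<lambda>z. \<psi> z * \<beta> z) z)"
      by (intro set_integral_add(2) locally_integrable_mult_C0 li C0_infinity_partial \<psi>\<alpha> \<psi>\<beta>)
    also have "\<dots> = - ((LINT z:\<Omega>|lebesgue. hx z * (\<psi> z * \<alpha> z)) + (LINT z:\<Omega>|lebesgue. hy z * (\<psi> z * \<beta> z)))"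
      using hx(1) hy(1) \<psi>\<alpha> \<psi>\<beta> by (simp add: has_weak_partial_def)
    also have "(LINT z:\<Omega>|lebesgue. hx z * (\<psi> z * \<alpha> z)) + (LINT z:\<Omega>|lebesgue. hy z * (\<psi> z * \<beta> z))
        = (LINT z:\<Omega>|lebesgue. hx z * (\<psi> z * \<alpha> z) + hy z * (\<psi> z * \<beta> z))"
      by (intro set_integral_add(2)[symmetric] locally_integrable_mult_C0 li \<psi>\<alpha> \<psi>\<beta>)
    also have "\<dots> = (LINT z:\<Omega>|lebesgue. J z *\<^sub>R (G (f z) * \<phi> (f z)))"
    proof (rule set_lebesgue_integral_cong)
      show "\<Omega> \<in> sets lebesgue" using open_domain by simp
      show "\<forall>z. z \<in> \<Omega> \<longrightarrow> hx z * (\<psi> z * \<alpha> z) + hy z * (\<psi> z * \<beta> z) = J z *\<^sub>R (G (f z) * \<phi> (f z))"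
        by (auto simp: \<psi>_def G scaleR_conv_of_real field_simps J_nz)
    qed
    also have "\<dots> = (LINT z:\<Omega>|lebesgue. G z * \<phi> z)"
      by (rule set_integral_change_of_variables(2)[OF meas[OF G_L2 \<phi>], symmetric])
    finally show "(LINT z:\<Omega>|lebesgue. H z * partial v \<phi> z) = - (LINT z:\<Omega>|lebesgue. G z * \<phi> z)" .
  qed
qed

end

section \<open>The transported energy density in terms of complex derivatives\<close>

lemma dilatation_identity:
  fixes hx hy fx fy :: complex
  defines "a \<equiv> (hx - \<i> * hy) / 2" and "b \<equiv> (hx + \<i> * hy) / 2"
    and "F \<equiv> (fx - \<i> * fy) / 2" and "B \<equiv> (fx + \<i> * fy) / 2"
  shows "((cmod (hx * of_real (Im fy) - hy * of_real (Im fx)))\<^sup>2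
      + (cmod (hy * of_real (Re fx) - hx * of_real (Re fy)))\<^sup>2) / 2
    = ((cmod a)\<^sup>2 + (cmod b)\<^sup>2) * ((cmod F)\<^sup>2 + (cmod B)\<^sup>2) - 4 * Re (a * cnj b * B * cnj F)"
    and "Re fx * Im fy - Im fx * Re fy = (cmod F)\<^sup>2 - (cmod B)\<^sup>2"
proof -
  obtain h1 h2 h3 h4 f1 f2 f3 f4 where
    eq: "hx = Complex h1 h2" "hy = Complex h3 h4" "fx = Complex f1 f2" "fy = Complex f3 f4"
    by (metis complex.exhaust)
  show "Re fx * Im fy - Im fx * Re fy = (cmod F)\<^sup>2 - (cmod B)\<^sup>2"
    unfolding F_def B_def cmod_power2 eq
    by (simp add: power2_eq_square field_simps)
  show "((cmod (hx * of_real (Im fy) - hy * of_real (Im fx)))\<^sup>2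
      + (cmod (hy * of_real (Re fx) - hx * of_real (Re fy)))\<^sup>2) / 2
    = ((cmod a)\<^sup>2 + (cmod b)\<^sup>2) * ((cmod F)\<^sup>2 + (cmod B)\<^sup>2) - 4 * Re (a * cnj b * B * cnj F)"
    unfolding a_def b_def F_def B_def cmod_power2 eq
    by (simp add: power2_eq_square) (simp add: field_simps)
qed

context domain_diffeo
begin

lemma partial_compose_f:
  assumes "smooth \<phi>"
  shows "partial v (\<lambda>z. \<phi> (f z)) z
    = of_real (Re (partial v f z)) * partial 1 \<phi> (f z) + of_real (Im (partial v f z)) * partial \<i> \<phi> (f z)"
proof -
  have C: "C_k (Suc 0) \<phi>" "C_k (Suc 0) f"
    using assms smooth_f unfolding smooth_def by blast+
  show ?thesis
    using partial_eqI[OF partial_compose[OF C]] partial_real_linear[OF C(1)] by metis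
qed

lemma partial_compose_f_mult:
  assumes "smooth \<phi>" "bounded_linear L"
  shows "partial v (\<lambda>z. \<phi> (f z) * L (partial w f z)) z
    = \<phi> (f z) * L (partial v (partial w f) z)
      + (of_real (Re (partial v f z)) * partial 1 \<phi> (f z) + of_real (Im (partial v f z)) * partial \<i> \<phi> (f z))
        * L (partial w f z)"
  unfolding partial_mult[OF smooth_compose[OF assms(1) smooth_f] smooth_linear[OF assms(2) smooth_partial[OF smooth_f]]]
    partial_bounded_linear[OF assms(2) smooth_partial[OF smooth_f]] partial_compose_f[OF assms(1)] ..

text \<open>The Piola identity: the rows of the cofactor matrix of the derivative are divergence free,
  because mixed partial derivatives commute.\<close>

lemma piola:
  assumes \<phi>: "smooth \<phi>"
  shows "J z * partial 1 \<phi> (f z) = partial 1 (\<lambda>z. \<phi> (f z) * of_real (Im (partial \<i> f z))) z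
      + partial \<i> (\<lambda>z. \<phi> (f z) * - of_real (Im (partial 1 f z))) z"
    and "J z * partial \<i> \<phi> (f z) = partial 1 (\<lambda>z. \<phi> (f z) * - of_real (Re (partial \<i> f z))) z
      + partial \<i> (\<lambda>z. \<phi> (f z) * of_real (Re (partial 1 f z))) z"
proof -
  note lin = bounded_linear_of_real_Re bounded_linear_of_real_Im
    bounded_linear_minus[OF bounded_linear_of_real_Re] bounded_linear_minus[OF bounded_linear_of_real_Im]
  note D = lin[THEN partial_compose_f_mult[OF \<phi>]]
  show "J z * partial 1 \<phi> (f z) = partial 1 (\<lambda>z. \<phi> (f z) * of_real (Im (partial \<i> f z))) z
      + partial \<i> (\<lambda>z. \<phi> (f z) * - of_real (Im (partial 1 f z))) z"
    unfolding D partial_commute[OF smooth_f] by (simp add: J_eq algebra_simps)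
  show "J z * partial \<i> \<phi> (f z) = partial 1 (\<lambda>z. \<phi> (f z) * - of_real (Re (partial \<i> f z))) z
      + partial \<i> (\<lambda>z. \<phi> (f z) * of_real (Re (partial 1 f z))) z"
    unfolding D partial_commute[OF smooth_f] by (simp add: J_eq algebra_simps)
qed

lemma
  fixes h H :: "complex \<Rightarrow> complex"
  assumes h: "h \<in> W12 \<Omega>" and H: "\<And>z. z \<in> \<Omega> \<Longrightarrow> H (f z) = h z"
  defines "q \<equiv> \<lambda>z. (((cmod (weak_d_xi \<Omega> h z))\<^sup>2 + (cmod (weak_d_xibar \<Omega> h z))\<^sup>2)
        * ((cmod (d_xi f z))\<^sup>2 + (cmod (d_xibar f z))\<^sup>2)
      - 4 * Re (weak_d_xi \<Omega> h z * cnj (weak_d_xibar \<Omega> h z) * d_xibar f z * cnj (d_xi f z)))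
      / ((cmod (d_xi f z))\<^sup>2 - (cmod (d_xibar f z))\<^sup>2)"
  shows W12_transport: "H \<in> W12 \<Omega>"
    and energy_integrable_transport: "set_integrable lebesgue \<Omega> q"
    and energy_transport: "energy \<Omega> H = (LINT z:\<Omega>|lebesgue. q z)"
proof -
  define hx where "hx = weak_partial \<Omega> 1 h"
  define hy where "hy = weak_partial \<Omega> \<i> h"
  have hx: "has_weak_partial \<Omega> 1 h hx" "L2 \<Omega> hx" and hy: "has_weak_partial \<Omega> \<i> h hy" "L2 \<Omega> hy"
    unfolding hx_def hy_def by (rule W12_weak_partial[OF open_domain h]; simp)+
  have L2_h: "L2 \<Omega> h" using h by (simp add: W12_def)
  define p where "p z = complex_of_real (Re (partial 1 f z))" for z
  define q' where "q' z = - complex_of_real (Re (partial \<i> f z))" for z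
  define r where "r z = - complex_of_real (Im (partial 1 f z))" for z
  define s where "s z = complex_of_real (Im (partial \<i> f z))" for z
  have smooth: "smooth p" "smooth q'" "smooth r" "smooth s"
    unfolding p_def[abs_def] q'_def[abs_def] r_def[abs_def] s_def[abs_def]
    by (rule smooth_linear[OF _ smooth_partial[OF smooth_f]], 
        intro bounded_linear_minus bounded_linear_of_real_Re bounded_linear_of_real_Im)+
  have bound: "cmod (p z) \<le> M" "cmod (q' z) \<le> M" "cmod (r z) \<le> M" "cmod (s z) \<le> M" for z
    using partial_bound[of z] abs_Re_le_cmod[of "partial 1 f z"] abs_Re_le_cmod[of "partial \<i> f z"]
      abs_Im_le_cmod[of "partial 1 f z"] abs_Im_le_cmod[of "partial \<i> f z"]
    by (simp_all add: p_def q'_def r_def s_def)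
  \<comment> \<open>The chain rule with the inverse derivative of \<open>f\<close> written by
    Cramer's rule: cofactors over the determinant, evaluated at the preimage.\<close>
  define G1 where "G1 z = (hx (g z) * s (g z) + hy (g z) * r (g z)) / J (g z)" for z
  define G2 where "G2 z = (hx (g z) * q' (g z) + hy (g z) * p (g z)) / J (g z)" for z
  have G1: "has_weak_partial \<Omega> 1 H G1" "L2 \<Omega> G1"
    by (rule has_weak_partial_transport[OF L2_h hx hy smooth(4) bound(4) smooth(3) bound(3)
          piola(1)[folded r_def s_def] H]; simp add: G1_def)+
  have G2: "has_weak_partial \<Omega> \<i> H G2" "L2 \<Omega> G2"
    by (rule has_weak_partial_transport[OF L2_h hx hy smooth(2) bound(2) smooth(1) bound(1)
          piola(2)[folded p_def q'_def] H]; simp add: G2_def)+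
  show "H \<in> W12 \<Omega>"
    using L2_transport[OF L2_h H] G1 G2 unfolding W12_def by blast
  define e where "e z = ((cmod (G1 z))\<^sup>2 + (cmod (G2 z))\<^sup>2) / 2" for z
  have e: "set_integrable lebesgue \<Omega> e"
    unfolding e_def using G1 G2 by (intro set_integrable_divide set_integral_add) (auto simp: L2_def)
  then have meas: "set_borel_measurable lebesgue \<Omega> e"
    unfolding set_borel_measurable_def set_integrable_def by (rule borel_measurable_integrable)
  \<comment> \<open>The squares contribute \<open>1 / J\<^sup>2\<close> and the change of variables
    \<open>J\<close>; the numerator is then rewritten by \<open>dilatation_identity\<close>, whose
    second part is the denominator.\<close>
  have eq: "J z *\<^sub>R e (f z) = q z" for z
  proof -
    have "J z \<noteq> 0" using J_pos[of z] by simp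
    then have "J z *\<^sub>R e (f z) = ((cmod (hx z * s z + hy z * r z))\<^sup>2
        + (cmod (hx z * q' z + hy z * p z))\<^sup>2) / 2 / J z"
      by (simp add: e_def G1_def G2_def norm_divide power_divide power2_eq_square field_simps)
    also have "hx z * s z + hy z * r z
        = hx z * of_real (Im (partial \<i> f z)) - hy z * of_real (Im (partial 1 f z))"
      by (simp add: s_def r_def)
    also have "hx z * q' z + hy z * p z
        = hy z * of_real (Re (partial 1 f z)) - hx z * of_real (Re (partial \<i> f z))"
      by (simp add: p_def q'_def)
    finally show ?thesis
      unfolding dilatation_identity J_eq q_def
      by (simp only: weak_d_xi_def weak_d_xibar_def d_xi_def d_xibar_def hx_def hy_def)
  qed
  show "set_integrable lebesgue \<Omega> q"
    using set_integral_change_of_variables(1)[OF meas] e by (simp only: eq)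
  show "energy \<Omega> H = (LINT z:\<Omega>|lebesgue. q z)"
    unfolding energy_eq[OF open_domain G1(1) G2(1) G1(2) G2(2)] e_def[symmetric]
    using set_integral_change_of_variables(2)[OF meas] by (simp only: eq)
qed

end

subsection \<open>Inner variations\<close>

lemma C0_infinity_partial_bound:
  assumes "\<eta> \<in> C0_infinity \<Omega>"
  obtains L where "L > 0" "\<And>z. cmod (partial 1 \<eta> z) \<le> L" "\<And>z. cmod (partial \<i> \<eta> z) \<le> L"
proof -
  obtain A B where "\<And>z. cmod (partial 1 \<eta> z) \<le> A" "\<And>z. cmod (partial \<i> \<eta> z) \<le> B"
    using C0_infinity_bounded[OF C0_infinity_partial[OF assms]] by metis
  then show ?thesis
    using that[of "max 1 (max A B)"] by (simp add: le_max_iff_disj)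
qed

text \<open>The factor \<open>2\<close> comes from bounding both real coordinates of a direction by
  its modulus.\<close>

lemma lipschitz_of_partial_bound:
  assumes \<eta>: "smooth \<eta>" and L: "\<And>z. cmod (partial 1 \<eta> z) \<le> L" "\<And>z. cmod (partial \<i> \<eta> z) \<le> L"
  shows "cmod (\<eta> x - \<eta> y) \<le> 2 * L * cmod (x - y)"
proof (rule differentiable_bound[of UNIV])
  show "(\<eta> has_derivative (\<lambda>v. partial v \<eta> z)) (at z within UNIV)" for z
    using smooth_has_derivative[OF \<eta>] by simp
  show "onorm (\<lambda>v. partial v \<eta> z) \<le> 2 * L" for z
  proof (rule onorm_le)
    fix v
    have "C_k (Suc 0) \<eta>" using \<eta> unfolding smooth_def by blast
    from partial_real_linear[OF this, of v z]
    have "cmod (partial v \<eta> z) \<le> \<bar>Re v\<bar> * cmod (partial 1 \<eta> z) + \<bar>Im v\<bar> * cmod (partial \<i> \<eta> z)"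
      by (simp add: norm_triangle_le norm_mult)
    also have "\<dots> \<le> cmod v * L + cmod v * L"
      by (intro add_mono mult_mono abs_Re_le_cmod abs_Im_le_cmod L) auto
    finally show "cmod (partial v \<eta> z) \<le> 2 * L * cmod v" by simp
  qed
qed auto

lemma smooth_perturb: "smooth \<eta> \<Longrightarrow> smooth (perturb \<eta> \<epsilon>)"
  unfolding perturb_def[abs_def] by (intro smooth_add smooth_mult smooth_ident smooth_const)

lemma partial_perturb:
  assumes "smooth \<eta>"
  shows "partial v (perturb \<eta> \<epsilon>) z = v + of_real \<epsilon> * partial v \<eta> z"
proof (rule partial_eqI)
  show "(perturb \<eta> \<epsilon> has_derivative (\<lambda>v. v + of_real \<epsilon> * partial v \<eta> z)) (at z)"
    unfolding perturb_def[abs_def]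
    by (auto intro!: derivative_eq_intros smooth_has_derivative[OF assms])
qed

lemma d_xi_perturb: "smooth \<eta> \<Longrightarrow> d_xi (perturb \<eta> \<epsilon>) z = 1 + of_real \<epsilon> * d_xi \<eta> z"
  and d_xibar_perturb: "smooth \<eta> \<Longrightarrow> d_xibar (perturb \<eta> \<epsilon>) z = of_real \<epsilon> * d_xibar \<eta> z"
  by (simp_all add: d_xi_def d_xibar_def partial_perturb field_simps)

lemma perturb_bij:
  assumes lip: "\<And>x y. cmod (\<eta> x - \<eta> y) \<le> K * cmod (x - y)" and \<epsilon>: "\<bar>\<epsilon>\<bar> * K < 1" and K: "K \<ge> 0"
  obtains g where "\<And>z. perturb \<eta> \<epsilon> (g z) = z" "\<And>z. g (perturb \<eta> \<epsilon> z) = z" "continuous_on UNIV g"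
proof -
  have lip': "cmod (of_real \<epsilon> * \<eta> x - of_real \<epsilon> * \<eta> y) \<le> \<bar>\<epsilon>\<bar> * K * cmod (x - y)" for x y
    using mult_left_mono[OF lip[of x y], of "\<bar>\<epsilon>\<bar>"]
    by (simp add: norm_mult right_diff_distrib[symmetric] mult.assoc)
  \<comment> \<open>One estimate with two uses: injectivity, and a Lipschitz bound that makes the
    inverse continuous.\<close>
  have expand: "(1 - \<bar>\<epsilon>\<bar> * K) * cmod (x - y) \<le> cmod (perturb \<eta> \<epsilon> x - perturb \<eta> \<epsilon> y)" for x y
    using lip'[of x y] norm_triangle_ineq2[of "x - y" "of_real \<epsilon> * \<eta> y - of_real \<epsilon> * \<eta> x"]
    by (simp add: perturb_def algebra_simps norm_minus_commute)
  have inj: "inj (perturb \<eta> \<epsilon>)"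
  proof (rule injI)
    fix x y assume "perturb \<eta> \<epsilon> x = perturb \<eta> \<epsilon> y"
    with expand[of x y] \<epsilon> show "x = y" by (simp add: mult_le_0_iff)
  qed
  have surj: "\<exists>x. perturb \<eta> \<epsilon> x = z" for z
  proof -
    have "\<exists>!x. z - of_real \<epsilon> * \<eta> x = x"
    proof (rule banach_fix_type)
      show "\<forall>x y. dist (z - of_real \<epsilon> * \<eta> x) (z - of_real \<epsilon> * \<eta> y) \<le> \<bar>\<epsilon>\<bar> * K * dist x y"
        using lip' by (simp add: dist_norm norm_minus_commute)
    qed (use \<epsilon> K in auto)
    then obtain x where "z - of_real \<epsilon> * \<eta> x = x" by auto
    then show ?thesis by (auto simp: perturb_def algebra_simps intro!: exI[of _ x])
  qed
  define g where "g = inv (perturb \<eta> \<epsilon>)"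
  have g: "perturb \<eta> \<epsilon> (g z) = z" for z
    unfolding g_def by (rule f_inv_into_f) (metis surj rangeI)
  have "cmod (g x - g y) \<le> (1 / (1 - \<bar>\<epsilon>\<bar> * K)) * cmod (x - y)" for x y
    using expand[of "g x" "g y"] \<epsilon> by (simp add: g field_simps)
  then have "(1 / (1 - \<bar>\<epsilon>\<bar> * K))-lipschitz_on UNIV g"
    using \<epsilon> by (intro lipschitz_onI) (auto simp: dist_norm)
  then have "continuous_on UNIV g" by (rule lipschitz_on_continuous_on)
  moreover have "g (perturb \<eta> \<epsilon> z) = z" for z
    unfolding g_def using inj by simp
  ultimately show ?thesis using g that by blast
qed

text \<open>Points outside \<open>\<Omega>\<close> are fixed. If a point of \<open>\<Omega>\<close>
  had its image outside, that image would be its own image too, and injectivity would identify the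
  two points.\<close>

lemma perturb_in_domain_iff:
  assumes \<eta>: "\<eta> \<in> C0_infinity \<Omega>" and inj: "inj (perturb \<eta> \<epsilon>)"
  shows "perturb \<eta> \<epsilon> z \<in> \<Omega> \<longleftrightarrow> z \<in> \<Omega>"
proof -
  obtain K where K: "K \<subseteq> \<Omega>" "\<And>z. z \<notin> K \<Longrightarrow> \<eta> z = 0"
    using \<eta> by (rule C0_infinityE) blast
  then have id: "perturb \<eta> \<epsilon> z = z" if "z \<notin> \<Omega>" for z
    using that by (auto simp: perturb_def)
  with injD[OF inj] show ?thesis by metis
qed

text \<open>The bound \<open>1 / 8\<close> meets every requirement: the Lipschitz bound
  \<open>2 * L\<close> yields a contraction factor of at most \<open>1 / 4\<close>, the Jacobian is
  at least \<open>(7 / 8)\<^sup>2 - (1 / 8)\<^sup>2 = 3 / 4\<close>, and the coordinate derivatives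
  are at most \<open>9 / 8\<close>. The locale constants \<open>1 / 2\<close> and \<open>2\<close>
  are rounded versions.\<close>

lemma perturb_domain_diffeo:
  assumes \<Omega>: "open \<Omega>" and \<eta>: "\<eta> \<in> C0_infinity \<Omega>"
    and L: "\<And>z. cmod (partial 1 \<eta> z) \<le> L" "\<And>z. cmod (partial \<i> \<eta> z) \<le> L"
    and \<epsilon>: "\<bar>\<epsilon>\<bar> * L \<le> 1 / 8"
  obtains g where "domain_diffeo (perturb \<eta> \<epsilon>) g
    (\<lambda>z. (cmod (d_xi (perturb \<eta> \<epsilon>) z))\<^sup>2 - (cmod (d_xibar (perturb \<eta> \<epsilon>) z))\<^sup>2) \<Omega> 2 (1 / 2)"
proof -
  let ?f = "perturb \<eta> \<epsilon>"
  let ?J = "\<lambda>z. (cmod (d_xi ?f z))\<^sup>2 - (cmod (d_xibar ?f z))\<^sup>2"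
  have sm: "smooth \<eta>" by (rule C0_infinity_smooth[OF \<eta>])
  have "L \<ge> 0" using L(1)[of 0] norm_ge_zero order_trans by blast
  obtain g where g: "\<And>z. ?f (g z) = z" "\<And>z. g (?f z) = z" "continuous_on UNIV g"
    using perturb_bij[of \<eta> "2 * L" \<epsilon>] lipschitz_of_partial_bound[OF sm L] \<epsilon> \<open>L \<ge> 0\<close> by force
  have J: "?J z = Re (partial 1 ?f z) * Im (partial \<i> ?f z) - Im (partial 1 ?f z) * Re (partial \<i> ?f z)" for z
    unfolding dilatation_identity(2) d_xi_def d_xibar_def ..
  have close: "cmod (of_real \<epsilon> * partial 1 \<eta> z) \<le> 1 / 8" "cmod (of_real \<epsilon> * partial \<i> \<eta> z) \<le> 1 / 8" for z
    using mult_left_mono[OF L(1)[of z], of "\<bar>\<epsilon>\<bar>"] mult_left_mono[OF L(2)[of z], of "\<bar>\<epsilon>\<bar>"] \<epsilon>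
    by (auto simp: norm_mult)
  have J_bound: "?J z \<ge> 1 / 2" for z
  proof -
    define u where "u = of_real \<epsilon> * partial 1 \<eta> z"
    define w where "w = of_real \<epsilon> * partial \<i> \<eta> z"
    have "\<bar>Re u\<bar> \<le> 1 / 8" "\<bar>Im u\<bar> \<le> 1 / 8" "\<bar>Re w\<bar> \<le> 1 / 8" "\<bar>Im w\<bar> \<le> 1 / 8"
      using close[of z] abs_Re_le_cmod abs_Im_le_cmod order_trans unfolding u_def w_def by blast+
    then have "(7 / 8) * (7 / 8) \<le> (1 + Re u) * (1 + Im w)" "\<bar>Im u * Re w\<bar> \<le> (1 / 8) * (1 / 8)"
      unfolding abs_mult by - (rule mult_mono; linarith)+
    moreover have "?J z = (1 + Re u) * (1 + Im w) - Im u * Re w"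
      unfolding J partial_perturb[OF sm] u_def w_def by simp
    ultimately show ?thesis by linarith
  qed
  show ?thesis
  proof (rule that, unfold_locales)
    show "smooth ?f" by (rule smooth_perturb[OF sm])
    then show "(?f has_derivative (\<lambda>v. partial v ?f z)) (at z)" for z
      by (rule smooth_has_derivative)
    show "?J z > 0" for z
      using J_bound[of z] by linarith
    show "continuous_on UNIV ?J"
      unfolding J by (intro continuous_intros smooth_continuous smooth_partial smooth_perturb sm)
    have "inj ?f" using g(2) by (metis injI)
    then show "?f z \<in> \<Omega> \<longleftrightarrow> z \<in> \<Omega>" for z
      by (rule perturb_in_domain_iff[OF \<eta>])
    show "cmod (partial 1 ?f z) \<le> 2" "cmod (partial \<i> ?f z) \<le> 2" for z
      using close[of z] norm_triangle_ineq[of 1 "of_real \<epsilon> * partial 1 \<eta> z"]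
        norm_triangle_ineq[of \<i> "of_real \<epsilon> * partial \<i> \<eta> z"]
      by (simp_all add: partial_perturb[OF sm])
  qed (use g \<Omega> J J_bound in auto)
qed

section \<open>Pointwise second order expansion of the energy density\<close>

lemma energy_density_expansion:
  fixes a b m n :: complex and \<epsilon> K :: real
  defines "F \<equiv> 1 + of_real \<epsilon> * m" and "B \<equiv> of_real \<epsilon> * n" and "A \<equiv> (cmod a)\<^sup>2 + (cmod b)\<^sup>2"
  assumes K: "cmod m \<le> K" "cmod n \<le> K" and \<epsilon>: "\<bar>\<epsilon>\<bar> \<le> 1" and J: "(cmod F)\<^sup>2 - (cmod B)\<^sup>2 \<ge> 1 / 2"
  shows "\<bar>(A * ((cmod F)\<^sup>2 + (cmod B)\<^sup>2) - 4 * Re (a * cnj b * B * cnj F)) / ((cmod F)\<^sup>2 - (cmod B)\<^sup>2)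
      - (A - 4 * \<epsilon> * Re (a * cnj b * n)
         + 4 * \<epsilon>\<^sup>2 * (1 / 2 * (A * (cmod n)\<^sup>2) + Re (a * cnj b * m * n)))\<bar>
    \<le> (8 * K\<^sup>2 * (2 * K + K\<^sup>2) + 4 * K ^ 3) * \<bar>\<epsilon>\<bar> ^ 3 * A"
proof -
  define J where "J = (cmod F)\<^sup>2 - (cmod B)\<^sup>2"
  \<comment> \<open>\<open>E1\<close> and \<open>E2\<close> are the exact errors in the expansions
    \<open>e1\<close> and \<open>e2\<close> of the two quotients by \<open>J\<close>. No Taylor
    theorem is used: each error visibly has three factors of order \<open>\<epsilon>\<close>,
    because \<open>J - 1\<close> has one.\<close>
  define E1 where "E1 = 2 * \<epsilon>\<^sup>2 * (cmod n)\<^sup>2 * (1 - J) / J"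
  define E2 where "E2 = of_real (\<epsilon> / J) * n * (of_real (\<epsilon>\<^sup>2 * ((cmod n)\<^sup>2 - (cmod m)\<^sup>2)) + of_real (\<epsilon> * (J - 1)) * m)"
  have J2: "J \<ge> 1 / 2" using J by (simp add: J_def)
  then have "J \<noteq> 0" by auto
  have K0: "K \<ge> 0" using K(1) norm_ge_zero order_trans by blast
  have J_expand: "J = 1 + 2 * \<epsilon> * Re m + \<epsilon>\<^sup>2 * ((cmod m)\<^sup>2 - (cmod n)\<^sup>2)"
    unfolding J_def F_def B_def cmod_power2 by (simp add: power2_eq_square algebra_simps)
  have sq: "(cmod m)\<^sup>2 \<le> K\<^sup>2" "(cmod n)\<^sup>2 \<le> K\<^sup>2"
    by (intro power_mono K norm_ge_zero)+
  then have diff: "\<bar>(cmod m)\<^sup>2 - (cmod n)\<^sup>2\<bar> \<le> K\<^sup>2" "\<bar>(cmod n)\<^sup>2 - (cmod m)\<^sup>2\<bar> \<le> K\<^sup>2"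
    using zero_le_power2[of "cmod m"] zero_le_power2[of "cmod n"] by (simp_all only: abs_le_iff) linarith+
  \<comment> \<open>The quadratic term of \<open>J\<close> is made linear by
    \<open>\<bar>\<epsilon>\<bar> \<le> 1\<close>.\<close>
  have J1: "\<bar>J - 1\<bar> \<le> \<bar>\<epsilon>\<bar> * (2 * K + K\<^sup>2)"
  proof -
    have "\<bar>J - 1\<bar> \<le> \<bar>\<epsilon>\<bar> * (2 * \<bar>Re m\<bar>) + \<bar>\<epsilon>\<bar> * (\<bar>\<epsilon>\<bar> * \<bar>(cmod m)\<^sup>2 - (cmod n)\<^sup>2\<bar>)"
      unfolding J_expand by (rule order_trans[OF _ order_trans[OF abs_triangle_ineq]]) 
        (auto simp: abs_mult power2_eq_square)
    also have "\<dots> \<le> \<bar>\<epsilon>\<bar> * (2 * K) + \<bar>\<epsilon>\<bar> * (1 * K\<^sup>2)"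
      using abs_Re_le_cmod[of m] K(1) \<epsilon> diff
      by (intro add_mono mult_left_mono mult_mono) auto
    finally show ?thesis by (simp add: algebra_simps)
  qed
  have inv_J: "\<bar>1 / J\<bar> \<le> 2"
    using J2 by (simp add: field_simps)
  have E1: "\<bar>E1\<bar> \<le> 4 * K\<^sup>2 * (2 * K + K\<^sup>2) * \<bar>\<epsilon>\<bar> ^ 3"
  proof -
    have "\<bar>E1\<bar> = 2 * \<epsilon>\<^sup>2 * (cmod n)\<^sup>2 * (\<bar>J - 1\<bar> * \<bar>1 / J\<bar>)"
      by (simp add: E1_def abs_mult abs_divide abs_minus_commute)
    also have "\<dots> \<le> 2 * \<epsilon>\<^sup>2 * K\<^sup>2 * ((\<bar>\<epsilon>\<bar> * (2 * K + K\<^sup>2)) * 2)"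
      using sq J1 inv_J K0 by (intro mult_mono) auto
    also have "\<dots> = 4 * K\<^sup>2 * (2 * K + K\<^sup>2) * \<bar>\<epsilon>\<bar> ^ 3"
      by (simp add: power2_abs[of \<epsilon>, symmetric] power2_eq_square power3_eq_cube algebra_simps del: power2_abs)
    finally show ?thesis .
  qed
  have E2: "cmod E2 \<le> 2 * (K ^ 3 + K\<^sup>2 * (2 * K + K\<^sup>2)) * \<bar>\<epsilon>\<bar> ^ 3"
  proof -
    have "cmod (of_real (\<epsilon>\<^sup>2 * ((cmod n)\<^sup>2 - (cmod m)\<^sup>2)) + of_real (\<epsilon> * (J - 1)) * m)
        \<le> \<bar>\<epsilon>\<bar>\<^sup>2 * \<bar>(cmod n)\<^sup>2 - (cmod m)\<^sup>2\<bar> + \<bar>\<epsilon>\<bar> * \<bar>J - 1\<bar> * cmod m"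
      by (rule order_trans[OF norm_triangle_ineq]) (simp only: norm_mult norm_of_real abs_mult power_abs order_refl)
    also have "\<dots> \<le> \<bar>\<epsilon>\<bar>\<^sup>2 * K\<^sup>2 + \<bar>\<epsilon>\<bar> * (\<bar>\<epsilon>\<bar> * (2 * K + K\<^sup>2)) * K"
      using diff J1 K K0 by (intro add_mono mult_mono) auto
    finally have *: "cmod (of_real (\<epsilon>\<^sup>2 * ((cmod n)\<^sup>2 - (cmod m)\<^sup>2)) + of_real (\<epsilon> * (J - 1)) * m)
        \<le> \<bar>\<epsilon>\<bar>\<^sup>2 * K\<^sup>2 + \<bar>\<epsilon>\<bar> * (\<bar>\<epsilon>\<bar> * (2 * K + K\<^sup>2)) * K" .
    have "cmod E2 = \<bar>\<epsilon>\<bar> * \<bar>1 / J\<bar> * cmod n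
        * cmod (of_real (\<epsilon>\<^sup>2 * ((cmod n)\<^sup>2 - (cmod m)\<^sup>2)) + of_real (\<epsilon> * (J - 1)) * m)"
      unfolding E2_def norm_mult by (simp add: abs_divide norm_divide)
    also have "\<dots> \<le> \<bar>\<epsilon>\<bar> * 2 * K * (\<bar>\<epsilon>\<bar>\<^sup>2 * K\<^sup>2 + \<bar>\<epsilon>\<bar> * (\<bar>\<epsilon>\<bar> * (2 * K + K\<^sup>2)) * K)"
      using * inv_J K K0 by (intro mult_mono) auto
    also have "\<dots> = 2 * (K ^ 3 + K\<^sup>2 * (2 * K + K\<^sup>2)) * \<bar>\<epsilon>\<bar> ^ 3"
      by (simp add: power2_eq_square power3_eq_cube algebra_simps)
    finally show ?thesis .
  qed
  have e1: "((cmod F)\<^sup>2 + (cmod B)\<^sup>2) / J = 1 + 2 * \<epsilon>\<^sup>2 * (cmod n)\<^sup>2 + E1"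
  proof -
    have "(cmod B)\<^sup>2 = \<epsilon>\<^sup>2 * (cmod n)\<^sup>2"
      by (simp add: B_def norm_mult power_mult_distrib)
    then have "(cmod F)\<^sup>2 + (cmod B)\<^sup>2 = J + 2 * \<epsilon>\<^sup>2 * (cmod n)\<^sup>2"
      by (simp add: J_def)
    with \<open>J \<noteq> 0\<close> show ?thesis by (simp add: E1_def field_simps)
  qed
  \<comment> \<open>To first order \<open>cnj F\<close> contributes \<open>cnj m\<close>, while
    division by \<open>J\<close> subtracts \<open>m + cnj m\<close>. What is left is
    \<open>- m\<close>, which is why \<open>m\<close> appears without conjugation in the second
    order term.\<close>
  have e2: "B * cnj F / of_real J = of_real \<epsilon> * n - of_real (\<epsilon>\<^sup>2) * m * n + E2"
  proof -
    have "of_real J * (of_real \<epsilon> * n - of_real (\<epsilon>\<^sup>2) * m * n)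
        + of_real \<epsilon> * n * (of_real (\<epsilon>\<^sup>2 * ((cmod n)\<^sup>2 - (cmod m)\<^sup>2)) + of_real (\<epsilon> * (J - 1)) * m)
        = of_real \<epsilon> * n * of_real (J + \<epsilon>\<^sup>2 * ((cmod n)\<^sup>2 - (cmod m)\<^sup>2)) - of_real (\<epsilon>\<^sup>2) * m * n"
      by (simp add: algebra_simps power2_eq_square)
    also have "of_real (J + \<epsilon>\<^sup>2 * ((cmod n)\<^sup>2 - (cmod m)\<^sup>2)) = 1 + of_real \<epsilon> * (m + cnj m)"
      unfolding J_expand complex_add_cnj by (simp add: algebra_simps)
    also have "of_real \<epsilon> * n * (1 + of_real \<epsilon> * (m + cnj m)) - of_real (\<epsilon>\<^sup>2) * m * n = B * cnj F"
      by (simp add: B_def F_def algebra_simps power2_eq_square)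
    finally have "B * cnj F = of_real J * (of_real \<epsilon> * n - of_real (\<epsilon>\<^sup>2) * m * n)
        + of_real \<epsilon> * n * (of_real (\<epsilon>\<^sup>2 * ((cmod n)\<^sup>2 - (cmod m)\<^sup>2)) + of_real (\<epsilon> * (J - 1)) * m)" ..
    with \<open>J \<noteq> 0\<close> show ?thesis by (simp add: E2_def add_divide_distrib)
  qed
  have "(A * ((cmod F)\<^sup>2 + (cmod B)\<^sup>2) - 4 * Re (a * cnj b * B * cnj F)) / J
      = A * (((cmod F)\<^sup>2 + (cmod B)\<^sup>2) / J) - 4 * Re (a * cnj b * (B * cnj F / of_real J))"
    by (simp add: diff_divide_distrib mult.assoc flip: Re_divide_of_real)
  also have "\<dots> = (A - 4 * \<epsilon> * Re (a * cnj b * n)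
         + 4 * \<epsilon>\<^sup>2 * (1 / 2 * (A * (cmod n)\<^sup>2) + Re (a * cnj b * m * n)))
         + (A * E1 - 4 * Re (a * cnj b * E2))"
    unfolding e1 e2 by (simp add: algebra_simps)
  finally have "\<bar>(A * ((cmod F)\<^sup>2 + (cmod B)\<^sup>2) - 4 * Re (a * cnj b * B * cnj F)) / J
      - (A - 4 * \<epsilon> * Re (a * cnj b * n)
         + 4 * \<epsilon>\<^sup>2 * (1 / 2 * (A * (cmod n)\<^sup>2) + Re (a * cnj b * m * n)))\<bar>
      = \<bar>A * E1 - 4 * Re (a * cnj b * E2)\<bar>" by simp
  also have "\<dots> \<le> \<bar>A * E1\<bar> + 4 * \<bar>Re (a * cnj b * E2)\<bar>"
    using abs_triangle_ineq4[of "A * E1" "4 * Re (a * cnj b * E2)"] by (simp only: abs_mult abs_numeral)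
  also have "\<dots> \<le> A * \<bar>E1\<bar> + 4 * (A / 2 * cmod E2)"
  proof (intro add_mono mult_left_mono)
    have "\<bar>Re (a * cnj b * E2)\<bar> \<le> cmod a * cmod b * cmod E2"
      using abs_Re_le_cmod[of "a * cnj b * E2"] by (simp add: norm_mult)
    \<comment> \<open>The inequality of arithmetic and geometric means; it makes the whole remainder
      proportional to \<open>A\<close>, hence integrable.\<close>
    also have "cmod a * cmod b \<le> A / 2"
      using sum_squares_bound[of "cmod a" "cmod b"] by (simp add: A_def)
    finally show "\<bar>Re (a * cnj b * E2)\<bar> \<le> A / 2 * cmod E2"
      by (simp add: mult_right_mono)
  qed (auto simp: A_def abs_mult)
  also have "\<dots> \<le> A * (4 * K\<^sup>2 * (2 * K + K\<^sup>2) * \<bar>\<epsilon>\<bar> ^ 3)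
      + 4 * (A / 2 * (2 * (K ^ 3 + K\<^sup>2 * (2 * K + K\<^sup>2)) * \<bar>\<epsilon>\<bar> ^ 3))"
    by (intro add_mono mult_left_mono E1 E2) (auto simp: A_def)
  also have "\<dots> = (8 * K\<^sup>2 * (2 * K + K\<^sup>2) + 4 * K ^ 3) * \<bar>\<epsilon>\<bar> ^ 3 * A"
    by (simp add: algebra_simps)
  finally show ?thesis by (simp add: J_def)
qed

section \<open>Integrability of the coefficients and integration of the pointwise expansion\<close>

lemma set_borel_measurable_energy_mult:
  fixes a b c :: "complex \<Rightarrow> complex"
  assumes "L2 \<Omega> a" "L2 \<Omega> b" "continuous_on UNIV c"
  shows "set_borel_measurable lebesgue \<Omega> (\<lambda>z. a z * cnj (b z) * c z)"
proof -
  have [measurable]: "(\<lambda>z. indicator \<Omega> z *\<^sub>R a z) \<in> borel_measurable lebesgue"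
      "(\<lambda>z. indicator \<Omega> z *\<^sub>R b z) \<in> borel_measurable lebesgue"
    using assms by (auto simp: L2_def set_borel_measurable_def)
  have "cnj \<in> borel_measurable borel"
    by (intro borel_measurable_continuous_onI continuous_intros)
  from measurable_compose[OF _ this, of "\<lambda>z. indicator \<Omega> z *\<^sub>R b z" lebesgue]
  have [measurable]: "(\<lambda>z. cnj (indicator \<Omega> z *\<^sub>R b z)) \<in> borel_measurable lebesgue"
    by measurable
  have "(\<lambda>z. (indicator \<Omega> z *\<^sub>R a z) * cnj (indicator \<Omega> z *\<^sub>R b z)) \<in> borel_measurable lebesgue"
    by measurable
  also have "(\<lambda>z. (indicator \<Omega> z *\<^sub>R a z) * cnj (indicator \<Omega> z *\<^sub>R b z))
      = (\<lambda>z. indicator \<Omega> z *\<^sub>R (a z * cnj (b z)))"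
    by (auto simp: indicator_def)
  finally show ?thesis
    by (intro set_borel_measurable_mult_continuous[OF _ assms(3)]) (simp add: set_borel_measurable_def)
qed

lemma set_integrable_energy_mult:
  fixes a b c :: "complex \<Rightarrow> complex"
  assumes a: "L2 \<Omega> a" and b: "L2 \<Omega> b" and c: "continuous_on UNIV c" and C: "\<And>z. cmod (c z) \<le> C"
  shows "set_integrable lebesgue \<Omega> (\<lambda>z. a z * cnj (b z) * c z)"
proof (rule set_integrable_bound_L2[OF set_borel_measurable_energy_mult[OF a b c] a b])
  fix z
  have "cmod (a z * cnj (b z) * c z) \<le> ((cmod (a z))\<^sup>2 + (cmod (b z))\<^sup>2) * C"
    unfolding norm_mult complex_mod_cnj
  proof (rule mult_mono[OF _ C])
    show "cmod (a z) * cmod (b z) \<le> (cmod (a z))\<^sup>2 + (cmod (b z))\<^sup>2"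
      using sum_squares_bound[of "cmod (a z)" "cmod (b z)"] mult_nonneg_nonneg[of "cmod (a z)" "cmod (b z)"]
        norm_ge_zero[of "a z"] norm_ge_zero[of "b z"] by linarith
  qed auto
  then show "cmod (a z * cnj (b z) * c z) \<le> C * ((cmod (a z))\<^sup>2 + (cmod (b z))\<^sup>2)"
    by (simp add: mult.commute)
qed

lemma L2_weak_derivatives:
  assumes "open \<Omega>" "h \<in> W12 \<Omega>"
  shows "L2 \<Omega> (weak_d_xi \<Omega> h)" "L2 \<Omega> (weak_d_xibar \<Omega> h)"
proof -
  have w: "L2 \<Omega> (weak_partial \<Omega> 1 h)" "L2 \<Omega> (weak_partial \<Omega> \<i> h)"
    using W12_weak_partial(2)[OF assms] by auto
  have const: "L2 \<Omega> (\<lambda>z. u z * k)" if "L2 \<Omega> u" for u k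
    by (rule L2_mult_bounded[OF that, where B = "cmod k"]) auto
  have "weak_d_xi \<Omega> h = (\<lambda>z. weak_partial \<Omega> 1 h z * (1 / 2) + weak_partial \<Omega> \<i> h z * (- \<i> / 2))"
      "weak_d_xibar \<Omega> h = (\<lambda>z. weak_partial \<Omega> 1 h z * (1 / 2) + weak_partial \<Omega> \<i> h z * (\<i> / 2))"
    by (auto simp: weak_d_xi_def weak_d_xibar_def field_simps)
  then show "L2 \<Omega> (weak_d_xi \<Omega> h)" "L2 \<Omega> (weak_d_xibar \<Omega> h)"
    by (simp_all only: L2_add const w)
qed

theorem theorem1p7:
  fixes \<Omega> :: "complex set" and h \<eta> :: "complex \<Rightarrow> complex"
  assumes "open \<Omega>" and "connected \<Omega>" and "\<Omega> \<noteq> {}"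
    and "h \<in> W12 \<Omega>"
    and "\<eta> \<in> C0_infinity \<Omega>"
  shows "(\<forall>\<^sub>F \<epsilon> in nhds 0. bij_betw (perturb \<eta> \<epsilon>) \<Omega> \<Omega> \<and> inner_variation \<Omega> h \<eta> \<epsilon> \<in> W12 \<Omega>) \<and>
    (\<lambda>\<epsilon>::real. energy \<Omega> (inner_variation \<Omega> h \<eta> \<epsilon>) -
       (energy \<Omega> h
        - 4 * \<epsilon> * Re (LINT \<xi>:\<Omega>|lebesgue.
            weak_d_xi \<Omega> h \<xi> * cnj (weak_d_xibar \<Omega> h \<xi>) * d_xibar \<eta> \<xi>)
        + 4 * \<epsilon>\<^sup>2 *
          (1 / 2 * (LINT \<xi>:\<Omega>|lebesgue.
              ((cmod (weak_d_xi \<Omega> h \<xi>))\<^sup>2 + (cmod (weak_d_xibar \<Omega> h \<xi>))\<^sup>2) * (cmod (d_xibar \<eta> \<xi>))\<^sup>2)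
           + Re (LINT \<xi>:\<Omega>|lebesgue.
              weak_d_xi \<Omega> h \<xi> * cnj (weak_d_xibar \<Omega> h \<xi>) * d_xi \<eta> \<xi> * d_xibar \<eta> \<xi>))))
      \<in> O[at 0](\<lambda>\<epsilon>. \<bar>\<epsilon>\<bar> ^ 3)"
proof -
  define a where "a = weak_d_xi \<Omega> h"
  define b where "b = weak_d_xibar \<Omega> h"
  define m where "m = d_xi \<eta>"
  define n where "n = d_xibar \<eta>"
  define A where "A z = (cmod (a z))\<^sup>2 + (cmod (b z))\<^sup>2" for z
  note \<Omega> = \<open>open \<Omega>\<close> and h = \<open>h \<in> W12 \<Omega>\<close> and \<eta> = \<open>\<eta> \<in> C0_infinity \<Omega>\<close>
  have sm: "smooth \<eta>" by (rule C0_infinity_smooth[OF \<eta>])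
  obtain L where L: "L > 0" "\<And>z. cmod (partial 1 \<eta> z) \<le> L" "\<And>z. cmod (partial \<i> \<eta> z) \<le> L"
    using C0_infinity_partial_bound[OF \<eta>] by blast
  \<comment> \<open>The second entry gives \<open>\<bar>\<epsilon>\<bar> * L \<le> 1 / 8\<close> for
    the diffeomorphism, the first \<open>\<bar>\<epsilon>\<bar> \<le> 1\<close> for the
    expansion.\<close>
  define \<delta> where "\<delta> = min 1 (1 / (8 * L))"
  have "\<delta> > 0" using L(1) by (simp add: \<delta>_def)
  have ab: "L2 \<Omega> a" "L2 \<Omega> b"
    unfolding a_def b_def by (intro L2_weak_derivatives \<Omega> h)+
  have mn_cont: "continuous_on UNIV m" "continuous_on UNIV n"
    unfolding m_def n_def d_xi_def[abs_def] d_xibar_def[abs_def]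
    by (intro continuous_intros smooth_continuous smooth_partial sm; simp)+
  have mn: "cmod (m z) \<le> L" "cmod (n z) \<le> L" for z
  proof -
    have "cmod (partial 1 \<eta> z) + cmod (\<i> * partial \<i> \<eta> z) \<le> 2 * L"
      using L(2,3)[of z] by (simp add: norm_mult)
    with norm_triangle_ineq4[of "partial 1 \<eta> z" "\<i> * partial \<i> \<eta> z"]
      norm_triangle_ineq[of "partial 1 \<eta> z" "\<i> * partial \<i> \<eta> z"]
    show "cmod (m z) \<le> L" "cmod (n z) \<le> L"
      by (simp_all add: m_def n_def d_xi_def d_xibar_def norm_divide)
  qed
  have int_A: "set_integrable lebesgue \<Omega> A"
    unfolding A_def using ab by (intro set_integral_add) (auto simp: L2_def)
  have int_n: "set_integrable lebesgue \<Omega> (\<lambda>z. a z * cnj (b z) * n z)"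
    by (rule set_integrable_energy_mult[OF ab mn_cont(2) mn(2)])
  have int_mn: "set_integrable lebesgue \<Omega> (\<lambda>z. a z * cnj (b z) * m z * n z)"
    using set_integrable_energy_mult[OF ab continuous_on_mult[OF mn_cont], of "L * L"]
      mn L(1) by (simp add: norm_mult mult_mono mult.assoc)
  have int_An: "set_integrable lebesgue \<Omega> (\<lambda>z. A z * (cmod (n z))\<^sup>2)"
  proof (rule set_integrable_bound_L2[OF _ ab])
    have "n \<in> borel_measurable lebesgue"
      by (rule lebesgue_measurable_continuous[OF mn_cont(2)])
    then have "(\<lambda>z. (indicator \<Omega> z *\<^sub>R A z) * (cmod (n z))\<^sup>2) \<in> borel_measurable lebesgue"
      using borel_measurable_integrable[OF int_A[unfolded set_integrable_def]] by measurable
    then show "set_borel_measurable lebesgue \<Omega> (\<lambda>z. A z * (cmod (n z))\<^sup>2)"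
      by (simp add: set_borel_measurable_def mult.assoc)
    show "norm (A z * (cmod (n z))\<^sup>2) \<le> L\<^sup>2 * ((cmod (a z))\<^sup>2 + (cmod (b z))\<^sup>2)" for z
      using mult_left_mono[OF power_mono[OF mn(2)[of z] norm_ge_zero, of 2], of "A z"]
      by (simp add: A_def abs_mult mult.commute)
  qed
  \<comment> \<open>\<open>T\<close> is the density of the claimed quadratic polynomial and
    \<open>Q\<close> the exact transported density, so that the energies can be compared under one
    integral sign.\<close>
  define T where "T \<epsilon> z = A z - 4 * \<epsilon> * Re (a z * cnj (b z) * n z)
      + 4 * \<epsilon>\<^sup>2 * (1 / 2 * (A z * (cmod (n z))\<^sup>2) + Re (a z * cnj (b z) * m z * n z))" for \<epsilon> z
  define Q where "Q \<epsilon> z = (A z * ((cmod (1 + of_real \<epsilon> * m z))\<^sup>2 + (cmod (of_real \<epsilon> * n z))\<^sup>2)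
        - 4 * Re (a z * cnj (b z) * (of_real \<epsilon> * n z) * cnj (1 + of_real \<epsilon> * m z)))
      / ((cmod (1 + of_real \<epsilon> * m z))\<^sup>2 - (cmod (of_real \<epsilon> * n z))\<^sup>2)" for \<epsilon> z
  have int_Re: "set_integrable lebesgue \<Omega> (\<lambda>z. Re (u z))
      \<and> (LINT z:\<Omega>|lebesgue. Re (u z)) = Re (LINT z:\<Omega>|lebesgue. u z)"
    if "set_integrable lebesgue \<Omega> u" for u
    using integrable_Re[OF that[unfolded set_integrable_def]] integral_Re[OF that[unfolded set_integrable_def]]
    by (simp add: set_integrable_def set_lebesgue_integral_def)
  note Re_n = int_Re[OF int_n] and Re_mn = int_Re[OF int_mn]
  have int_T: "set_integrable lebesgue \<Omega> (T \<epsilon>)" for \<epsilon>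
    unfolding T_def
    by (intro set_integral_add set_integral_diff set_integrable_mult_right int_A int_An
        Re_n[THEN conjunct1] Re_mn[THEN conjunct1])
  have T_eq: "(LINT z:\<Omega>|lebesgue. T \<epsilon> z) = energy \<Omega> h - 4 * \<epsilon> * Re (LINT z:\<Omega>|lebesgue. a z * cnj (b z) * n z)
      + 4 * \<epsilon>\<^sup>2 * (1 / 2 * (LINT z:\<Omega>|lebesgue. A z * (cmod (n z))\<^sup>2)
        + Re (LINT z:\<Omega>|lebesgue. a z * cnj (b z) * m z * n z))" for \<epsilon>
  proof -
    have "energy \<Omega> h = (LINT z:\<Omega>|lebesgue. A z)"
      by (simp add: energy_def A_def a_def b_def)
    moreover have "(LINT z:\<Omega>|lebesgue. u z - 4 * \<epsilon> * v z + 4 * \<epsilon>\<^sup>2 * (1 / 2 * w z + x z))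
        = (LINT z:\<Omega>|lebesgue. u z) - 4 * \<epsilon> * (LINT z:\<Omega>|lebesgue. v z)
          + 4 * \<epsilon>\<^sup>2 * (1 / 2 * (LINT z:\<Omega>|lebesgue. w z) + (LINT z:\<Omega>|lebesgue. x z))"
      if "set_integrable lebesgue \<Omega> u" "set_integrable lebesgue \<Omega> v"
        "set_integrable lebesgue \<Omega> w" "set_integrable lebesgue \<Omega> x" for u v w x :: "complex \<Rightarrow> real"
      using that by (simp add: set_integral_add set_integral_diff)
    ultimately show ?thesis
      unfolding T_def Re_n[THEN conjunct2, symmetric] Re_mn[THEN conjunct2, symmetric]
      by (simp only: int_A int_An Re_n[THEN conjunct1] Re_mn[THEN conjunct1])
  qed
  define C where "C = 8 * L\<^sup>2 * (2 * L + L\<^sup>2) + 4 * L ^ 3"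
  have main: "bij_betw (perturb \<eta> \<epsilon>) \<Omega> \<Omega> \<and> inner_variation \<Omega> h \<eta> \<epsilon> \<in> W12 \<Omega>
      \<and> \<bar>energy \<Omega> (inner_variation \<Omega> h \<eta> \<epsilon>) - (LINT z:\<Omega>|lebesgue. T \<epsilon> z)\<bar>
        \<le> C * energy \<Omega> h * \<bar>\<epsilon>\<bar> ^ 3"
    if \<epsilon>: "\<bar>\<epsilon>\<bar> < \<delta>" for \<epsilon>
  proof -
    have "\<bar>\<epsilon>\<bar> * L \<le> 1 / 8" "\<bar>\<epsilon>\<bar> \<le> 1"
      using \<epsilon> L(1) by (auto simp: \<delta>_def field_simps)
    then obtain g where "domain_diffeo (perturb \<eta> \<epsilon>) g
        (\<lambda>z. (cmod (d_xi (perturb \<eta> \<epsilon>) z))\<^sup>2 - (cmod (d_xibar (perturb \<eta> \<epsilon>) z))\<^sup>2) \<Omega> 2 (1 / 2)"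
      using perturb_domain_diffeo[OF \<Omega> \<eta> L(2,3)] by blast
    then interpret domain_diffeo "perturb \<eta> \<epsilon>" g
      "\<lambda>z. (cmod (d_xi (perturb \<eta> \<epsilon>) z))\<^sup>2 - (cmod (d_xibar (perturb \<eta> \<epsilon>) z))\<^sup>2" \<Omega> 2 "1 / 2" .
    have bij: "bij_betw (perturb \<eta> \<epsilon>) \<Omega> \<Omega>"
      by (rule bij_betwI[where g = g]) (use f_in_domain_iff[of "g z" for z] in auto)
    \<comment> \<open>\<open>inner_variation\<close> inverts on \<open>\<Omega>\<close>, whereas
      \<open>g\<close> inverts on the plane; the transport lemmas only ask for this relation on
      \<open>\<Omega>\<close>.\<close>
    then have H: "inner_variation \<Omega> h \<eta> \<epsilon> (perturb \<eta> \<epsilon> z) = h z" if "z \<in> \<Omega>" for z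
      using that unfolding inner_variation_def by (simp add: bij_betw_def)
    note d = d_xi_perturb[OF sm] d_xibar_perturb[OF sm]
    have int_Q: "set_integrable lebesgue \<Omega> (Q \<epsilon>)"
      using energy_integrable_transport[OF h H]
      by (simp only: d Q_def[abs_def] A_def a_def b_def m_def n_def)
    have energy_Q: "energy \<Omega> (inner_variation \<Omega> h \<eta> \<epsilon>) = (LINT z:\<Omega>|lebesgue. Q \<epsilon> z)"
      using energy_transport[OF h H]
      by (simp only: d Q_def A_def a_def b_def m_def n_def)
    have bound: "\<bar>Q \<epsilon> z - T \<epsilon> z\<bar> \<le> C * \<bar>\<epsilon>\<bar> ^ 3 * A z" for z
      unfolding Q_def T_def A_def C_def
      by (rule energy_density_expansion[OF mn])
        (use \<open>\<bar>\<epsilon>\<bar> \<le> 1\<close> J_bound[of z] in \<open>simp_all only: d m_def n_def\<close>)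
    have int_diff: "set_integrable lebesgue \<Omega> (\<lambda>z. Q \<epsilon> z - T \<epsilon> z)"
      by (intro set_integral_diff int_Q int_T)
    have "\<bar>energy \<Omega> (inner_variation \<Omega> h \<eta> \<epsilon>) - (LINT z:\<Omega>|lebesgue. T \<epsilon> z)\<bar>
        = \<bar>LINT z:\<Omega>|lebesgue. Q \<epsilon> z - T \<epsilon> z\<bar>"
      using set_integral_diff(2)[OF int_Q int_T] by (simp add: energy_Q)
    also have "\<dots> \<le> (LINT z:\<Omega>|lebesgue. \<bar>Q \<epsilon> z - T \<epsilon> z\<bar>)"
      using set_integral_norm_bound[OF int_diff] by simp
    also have "\<dots> \<le> (LINT z:\<Omega>|lebesgue. C * \<bar>\<epsilon>\<bar> ^ 3 * A z)"
      by (intro set_integral_mono set_integrable_abs int_diff set_integrable_mult_right int_A bound)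
    \<comment> \<open>The integral of \<open>A\<close> is the energy of \<open>h\<close>, so the
      constant in the cubic bound does not depend on \<open>\<epsilon>\<close>.\<close>
    also have "\<dots> = C * energy \<Omega> h * \<bar>\<epsilon>\<bar> ^ 3"
      by (simp add: energy_def A_def a_def b_def)
    finally show ?thesis
      using bij W12_transport[OF h H] by blast
  qed
  have ev: "\<forall>\<^sub>F \<epsilon> in nhds 0. \<bar>\<epsilon>\<bar> < \<delta>"
    using \<open>\<delta> > 0\<close> by (auto simp: eventually_nhds_metric dist_real_def)
  show ?thesis
  proof
    show "\<forall>\<^sub>F \<epsilon> in nhds 0. bij_betw (perturb \<eta> \<epsilon>) \<Omega> \<Omega> \<and> inner_variation \<Omega> h \<eta> \<epsilon> \<in> W12 \<Omega>"
      using ev by eventually_elim (use main in blast)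
    have "(\<lambda>\<epsilon>. energy \<Omega> (inner_variation \<Omega> h \<eta> \<epsilon>) - (LINT z:\<Omega>|lebesgue. T \<epsilon> z))
        \<in> O[at 0](\<lambda>\<epsilon>. \<bar>\<epsilon>\<bar> ^ 3)"
    proof (rule bigoI)
      have "\<forall>\<^sub>F \<epsilon> in at 0. \<bar>\<epsilon>\<bar> < \<delta>"
        using ev by (auto simp: eventually_at_filter elim: eventually_mono)
      then show "\<forall>\<^sub>F \<epsilon> in at 0. norm (energy \<Omega> (inner_variation \<Omega> h \<eta> \<epsilon>) - (LINT z:\<Omega>|lebesgue. T \<epsilon> z))
          \<le> C * energy \<Omega> h * norm (\<bar>\<epsilon>\<bar> ^ 3)"
        by eventually_elim (use main in simp)
    qed
    then show "(\<lambda>\<epsilon>::real. energy \<Omega> (inner_variation \<Omega> h \<eta> \<epsilon>) -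
       (energy \<Omega> h
        - 4 * \<epsilon> * Re (LINT \<xi>:\<Omega>|lebesgue.
            weak_d_xi \<Omega> h \<xi> * cnj (weak_d_xibar \<Omega> h \<xi>) * d_xibar \<eta> \<xi>)
        + 4 * \<epsilon>\<^sup>2 *
          (1 / 2 * (LINT \<xi>:\<Omega>|lebesgue.
              ((cmod (weak_d_xi \<Omega> h \<xi>))\<^sup>2 + (cmod (weak_d_xibar \<Omega> h \<xi>))\<^sup>2) * (cmod (d_xibar \<eta> \<xi>))\<^sup>2)
           + Re (LINT \<xi>:\<Omega>|lebesgue.
              weak_d_xi \<Omega> h \<xi> * cnj (weak_d_xibar \<Omega> h \<xi>) * d_xi \<eta> \<xi> * d_xibar \<eta> \<xi>))))
      \<in> O[at 0](\<lambda>\<epsilon>. \<bar>\<epsilon>\<bar> ^ 3)"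
      unfolding T_eq A_def a_def b_def m_def n_def .
  qed
qed

end
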